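(* Let $k\ge 1$ be an integer and let $\tau_0,\tau_k,\tau_{k+1},\dots,\tau_{2k-1}$ be complex numbers with $|\tau_0|=1$ and $\tau_k\neq 0$. Assume that the associated $k\times k$ matrix $\mathbb P=\overline{\tau_0}\,TB$ (defined in the context) is hermitian. Fix $z_0\in\mathbb T\setminus\{1\}$ and let $\Theta$ be the $2\times 2$ rational matrix function associated with these data (defined in the context). Let $x\in\mathbb T\setminus\{\tau_0\}$ and let $b(z)=T_{\Theta(z)}(x)$. Let $s\in\mathcal S_{\mathrm{ev}_-(\mathbb P)}$ be a generalized Schur function such that $$s(z)=\tau_0+\sum_{i=k}^{2k-1}\tau_i(z-1)^i+O((z-1)^{2k})\quad\text{as } z\to 1 \text{ nontangentially},$$ and such that $$s(z)-b(z)=O((z-1)^{2k+2})\quad\text{as } z\to 1 \text{ nontangentially}.$$ Then $s(z)\equiv b(z)$.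
   Context: $\mathbb D$ is the open unit disk in $\mathbb C$ and $\mathbb T$ is the unit circle. Generalized Schur functions: for an integer $\kappa\ge 0$, $\mathcal S_\kappa$ is the set of functions $s$ meromorphic in $\mathbb D$ such that the kernel $k_s(z,w)=\dfrac{1-s(z)\overline{s(w)}}{1-z\overline w}$ has exactly $\kappa$ negative squares for $z,w$ in the domain of analyticity $\Omega(s)\subset\mathbb D$ of $s$; that is, for every $n$ and $w_1,\dots,w_n\in\Omega(s)$ the hermitian matrix $(k_s(w_\ell,w_j))_{\ell,j=1}^n$ has at most $\kappa$ strictly negative eigenvalues, and exactly $\kappa$ for some choice of $n,w_1,\dots,w_n$. The set $\mathcal S_0$ is the set of Schur functions (analytic functions $s$ on $\mathbb D$ with $|s|\le 1$). Nontangential convergence: for $K>1$ let $\Gamma_K=\{z\in\mathbb D: |z-1|<K(1-|z|)\}$. A relation $f(z)=O((z-1)^m)$ as $z\to1$ nontangentially means that for every $K>1$ there are $C,\delta>0$ with $|f(z)|\le C|z-1|^m$ for all $z\in\Gamma_K$ with $|z-1|<\delta$. For a hermitian matrix $\mathbb P$, $\mathrm{ev}_-(\mathbb P)$ is the number of strictly negative eigenvalues of $\mathbb P$, counted with multiplicity. Matrices: $T$ is the $k\times k$ lower triangular Toeplitz matrix with entries $T_{ij}=\tau_{k+i-j}$ for $i\ge j$ and $T_{ij}=0$ for $i<j$. $B$ is the $k\times k$ matrix with entries $B_{ij}=(-1)^{j-1}\binom{j-1}{i+j-k-1}$ if $i+j\ge k+1$ and $B_{ij}=0$ if $i+j<k+1$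 ($1\le i,j\le k$). Set $\mathbb P=\overline{\tau_0}\,TB$, which is invertible. Put $$R(z)=\begin{pmatrix}\dfrac1{1-z}&\dfrac{z}{(1-z)^2}&\cdots&\dfrac{z^{k-1}}{(1-z)^k}\end{pmatrix},\qquad p(z)=(1-z)^kR(z)\,\mathbb P^{-1}R(z_0)^*,$$ where $^*$ is the conjugate transpose; $p$ is a polynomial of degree at most $k-1$. Put $$\Theta(z)=\begin{pmatrix}a(z)&b_{12}(z)\\c(z)&d(z)\end{pmatrix}=I_2-\frac{(1-z\overline{z_0})p(z)}{(1-z)^k}\,\mathbf u\mathbf u^*J,\qquad J=\begin{pmatrix}1&0\\0&-1\end{pmatrix},\quad \mathbf u=\begin{pmatrix}1\\\overline{\tau_0}\end{pmatrix},$$ and $$T_{\Theta(z)}(x)=\frac{a(z)x+b_{12}(z)}{c(z)x+d(z)}.$$ The function $b(z)=T_{\Theta(z)}(x)$ is a rational function of $z$. *)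

theory Defs
  imports
    "HOL-Complex_Analysis.Complex_Analysis"
    "HOL-Library.Landau_Symbols"
    "Jordan_Normal_Form.Char_Poly"
    "Jordan_Normal_Form.Schur_Decomposition"
    "Jordan_Normal_Form.Gauss_Jordan_Elimination"
begin

definition hermitian_mat :: "complex mat \<Rightarrow> bool" where
  "hermitian_mat A \<longleftrightarrow> mat_adjoint A = A"

(* Meant for hermitian A: algebraic multiplicities of the negative real eigenvalues. *)
definition ev_neg :: "complex mat \<Rightarrow> nat" where
  "ev_neg A = (\<Sum>l | l < (0::real) \<and> eigenvalue A (complex_of_real l).
                  Polynomial.order (complex_of_real l) (char_poly A))"

definition analyticity_domain :: "(complex \<Rightarrow> complex) \<Rightarrow> complex set" where
  "analyticity_domain s = {z \<in> ball 0 1. s analytic_on {z}}"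

definition schur_kernel :: "(complex \<Rightarrow> complex) \<Rightarrow> complex \<Rightarrow> complex \<Rightarrow> complex" where
  "schur_kernel s z w = (1 - s z * cnj (s w)) / (1 - z * cnj w)"

definition kernel_mat :: "(complex \<Rightarrow> complex) \<Rightarrow> nat \<Rightarrow> (nat \<Rightarrow> complex) \<Rightarrow> complex mat" where
  "kernel_mat s n w = mat n n (\<lambda>(l, j). schur_kernel s (w l) (w j))"

(* A meromorphic function is represented by its normal form nicely_meromorphic_on:
   removable singularities are removed and the value at a pole is 0, so that the
   complement of analyticity_domain in the disk is exactly the set of poles. *)
definition gen_schur :: "nat \<Rightarrow> (complex \<Rightarrow> complex) set" where
  "gen_schur \<kappa> = {s. s nicely_meromorphic_on ball 0 1 \<and>
     (\<forall>n w. w ` {..<n} \<subseteq> analyticity_domain s \<longrightarrow> ev_neg (kernel_mat s n w) \<le> \<kappa>) \<and>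
     (\<exists>n w. w ` {..<n} \<subseteq> analyticity_domain s \<and> ev_neg (kernel_mat s n w) = \<kappa>)}"

definition stolz :: "real \<Rightarrow> complex set" where
  "stolz K = {z \<in> ball 0 1. norm (z - 1) < K * (1 - norm z)}"

definition nontangential_bigo :: "(complex \<Rightarrow> complex) \<Rightarrow> nat \<Rightarrow> bool" where
  "nontangential_bigo f m \<longleftrightarrow>
     (\<forall>K>1. f \<in> O[at 1 within stolz K](\<lambda>z. (z - 1) ^ m))"

(* Matrix indices are 0-based: the (i, j) entry below is the entry (i + 1, j + 1)
   of the usual 1-based formula. *)
definition toeplitz_T :: "nat \<Rightarrow> (nat \<Rightarrow> complex) \<Rightarrow> complex mat" where
  "toeplitz_T k \<tau> = mat k k (\<lambda>(i, j). if j \<le> i then \<tau> (k + i - j) else 0)"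

definition binom_B :: "nat \<Rightarrow> complex mat" where
  "binom_B k = mat k k (\<lambda>(i, j).
     if k \<le> i + j + 1 then (- 1) ^ j * of_nat (j choose (i + j + 1 - k)) else 0)"

definition pick_P :: "nat \<Rightarrow> (nat \<Rightarrow> complex) \<Rightarrow> complex mat" where
  "pick_P k \<tau> = cnj (\<tau> 0) \<cdot>\<^sub>m (toeplitz_T k \<tau> * binom_B k)"

definition row_R :: "nat \<Rightarrow> complex \<Rightarrow> complex mat" where
  "row_R k z = mat 1 k (\<lambda>(_, j). z ^ j / (1 - z) ^ (j + 1))"

definition poly_p :: "nat \<Rightarrow> (nat \<Rightarrow> complex) \<Rightarrow> complex \<Rightarrow> complex \<Rightarrow> complex" where
  "poly_p k \<tau> z0 z = (1 - z) ^ k *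
     (row_R k z * the (mat_inverse (pick_P k \<tau>)) * mat_adjoint (row_R k z0)) $$ (0, 0)"

definition mat_J :: "complex mat" where
  "mat_J = mat_of_rows_list 2 [[1, 0], [0, - 1]]"

definition col_u :: "complex \<Rightarrow> complex mat" where
  "col_u t = mat_of_rows_list 1 [[1], [cnj t]]"

definition Theta :: "nat \<Rightarrow> (nat \<Rightarrow> complex) \<Rightarrow> complex \<Rightarrow> complex \<Rightarrow> complex mat" where
  "Theta k \<tau> z0 z = 1\<^sub>m 2 -
     ((1 - z * cnj z0) * poly_p k \<tau> z0 z / (1 - z) ^ k) \<cdot>\<^sub>m
       (col_u (\<tau> 0) * mat_adjoint (col_u (\<tau> 0)) * mat_J)"

(* The value at a zero of the denominator is 0. For M = Theta k \<tau> z0 z this happens only at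
   poles of the rational function of z: if norm (\<tau> 0) = 1 then u* J u = 0, so det M = 1 and
   numerator and denominator have no common zero. This matches the convention of
   nicely_meromorphic_on. *)
definition linear_fractional :: "complex mat \<Rightarrow> complex \<Rightarrow> complex" where
  "linear_fractional M x =
     (M $$ (0, 0) * x + M $$ (0, 1)) / (M $$ (1, 0) * x + M $$ (1, 1))"

end

theory Submission
  imports
    Defs
    "Jordan_Normal_Form.Spectral_Radius"
    "HOL-Real_Asymp.Real_Asymp"
begin

text \<open>
  Put \<open>g = 1 - cnj \<tau>\<^sub>0 * s\<close> and write \<open>\<Theta> = I - \<phi> u u\<^sup>* J\<close>. In the coordinate \<open>1 / g\<close> the linear fractional
  transformation \<open>T\<^sub>\<Theta>\<close> is the translation by \<open>\<phi>\<close>, so the difference of \<open>s\<close> and \<open>b\<close> is measured by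
  \<open>F = 1 / g - \<phi> - 1 / (1 - cnj \<tau>\<^sub>0 * x)\<close>, and with \<open>X\<close> the inverse of the Pick matrix
  \<open>k\<^sub>s(z, w) = g(z) cnj(g(w)) (R(z) X R(w)\<^sup>* + (F(z) + cnj(F(w))) / (1 - z cnj(w)))\<close>.
  The first summand already has \<open>\<kappa> = ev\<^sub>-(X)\<close> negative squares. It is reproduced exactly by suitable
  combinations of \<open>k\<close> radial points tending to 1, along which the \<open>F\<close> summand disappears because
  \<open>F(r) = o(1 - r)\<close>. Hence the \<open>F\<close> summand, a Caratheodory kernel, is positive semidefinite. As in Julia's lemma,
  the Cauchy-Schwarz inequality for the points \<open>z\<close> and \<open>r \<rightarrow> 1\<close> then gives \<open>F(z) = 0\<close>.
\<close>

section \<open>Inertia of hermitian matrices\<close>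

text \<open>The kernel formula starts from
  \<open>1 - s(z) cnj(s(w)) = g(z) + cnj(g(w)) - g(z) cnj(g(w))\<close>. Dividing by
  \<open>g(z) cnj(g(w))\<close> leaves \<open>1 / g(z) + 1 / cnj(g(w)) - 1\<close>. As
  \<open>x\<close> is unimodular, the constant \<open>1 / (1 - cnj \<tau>\<^sub>0 * x)\<close> has
  real part 1/2 and absorbs exactly the \<open>- 1\<close>; the shift structure of the Pick matrix
  turns \<open>\<phi>\<close> into the \<open>X\<close> term. The order 2k + 2 matches this
  coordinate: \<open>F\<close> is a unimodular constant times the difference of \<open>s\<close> and
  \<open>b\<close>, divided by two functions of exact order k at 1. Two powers of 1 - r survive, and
  more than one is what makes the kernel of \<open>F\<close> vanish at pairs of points that both
  tend to 1. The obstacle is that only the negative squares of a sum are bounded. A negative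
  direction of the \<open>F\<close> summand need not add to those of the \<open>X\<close> summand,
  so counting alone proves nothing. Test vectors are required on which the two summands decouple,
  and the behaviour of \<open>F\<close> near 1 provides them.\<close>

lemma mat_adjoint_dim [simp]:
  "dim_row (mat_adjoint A) = dim_col A" "dim_col (mat_adjoint A) = dim_row A"
  by (simp_all add: mat_adjoint_def)

lemma mat_adjoint_carrier [simp]:
  "A \<in> carrier_mat n m \<Longrightarrow> mat_adjoint A \<in> carrier_mat m n"
  by (intro carrier_matI) (simp_all add: carrier_matD)

lemma mat_adjoint_index [simp]:
  "i < dim_col A \<Longrightarrow> j < dim_row A \<Longrightarrow> mat_adjoint A $$ (i, j) = conjugate (A $$ (j, i))"
  by (simp add: mat_adjoint_def mat_of_rows_def)

lemma mat_adjoint_mult: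
  fixes A B :: "'a::conjugatable_field mat"
  assumes "A \<in> carrier_mat n m" "B \<in> carrier_mat m l"
  shows "mat_adjoint (A * B) = mat_adjoint B * mat_adjoint A"
proof (rule eq_matI)
  fix i j assume "i < dim_row (mat_adjoint B * mat_adjoint A)" "j < dim_col (mat_adjoint B * mat_adjoint A)"
  then show "mat_adjoint (A * B) $$ (i, j) = (mat_adjoint B * mat_adjoint A) $$ (i, j)"
    using assms
    by (auto simp: scalar_prod_def sum_conjugate conjugate_dist_mul mult.commute intro!: sum.cong)
qed (use assms in auto)

lemma mat_adjoint_adjoint [simp]: "mat_adjoint (mat_adjoint A) = A"
  by (rule eq_matI) auto

lemma mat_adjoint_four_block:
  assumes "A \<in> carrier_mat n1 m1" "B \<in> carrier_mat n1 m2" "C \<in> carrier_mat n2 m1" "D \<in> carrier_mat n2 m2"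
  shows "mat_adjoint (four_block_mat A B C D) =
    four_block_mat (mat_adjoint A) (mat_adjoint C) (mat_adjoint B) (mat_adjoint D)"
  by (rule eq_matI) (use assms in \<open>auto simp: index_mat_four_block\<close>)

text \<open>An eigenvector, completed to an orthonormal basis, becomes the first column of
  \<open>W\<close>, which clears the first column of the conjugated matrix below its top entry.
  Hermitian symmetry then clears the first row as well and forces the eigenvalue to be real.\<close>

lemma hermitian_deflation:
  fixes A :: "complex mat"
  assumes A: "A \<in> carrier_mat (Suc n) (Suc n)" and herm: "mat_adjoint A = A"
  obtains W e A3 where "W \<in> carrier_mat (Suc n) (Suc n)" "mat_adjoint W * W = 1\<^sub>m (Suc n)"
    "A3 \<in> carrier_mat n n" "mat_adjoint A3 = A3"
    "mat_adjoint W * A * W = four_block_mat (mat 1 1 (\<lambda>_. complex_of_real e)) (0\<^sub>m 1 n) (0\<^sub>m n 1) A3"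
proof -
  let ?N = "Suc n"
  obtain e where "eigenvalue A e"
    using spectrum_non_empty[OF A] by (auto simp: spectrum_def)
  then obtain v where v: "v \<in> carrier_vec ?N" "v \<noteq> 0\<^sub>v ?N" "A *\<^sub>v v = e \<cdot>\<^sub>v v"
    using A by (auto simp: eigenvalue_def eigenvector_def)
  interpret cof_vec_space ?N "TYPE(complex)" .
  define bs where "bs = basis_completion v"
  note bc = basis_completion[OF v(1,2), folded bs_def]
  then obtain vs where bv: "bs = v # vs" by (cases bs) auto
  \<comment> \<open>\<open>gram_schmidt\<close> makes the basis orthogonal without normalising it
    and keeps its head \<open>v\<close>; the norms are divided out afterwards.\<close>
  define us where "us = gram_schmidt ?N bs"
  have us: "set us \<subseteq> carrier_vec ?N" "corthogonal us" "length us = ?N"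
    using gram_schmidt_result[OF bc(2,4,5) us_def] bc by auto
  have hdus: "hd us = v" unfolding us_def bv using v by simp
  define nrm where "nrm u = complex_of_real (sqrt (Re (u \<bullet>c u)))" for u :: "complex vec"
  have sq: "u \<bullet>c u = of_real (Re (u \<bullet>c u))" "Re (u \<bullet>c u) \<ge> 0" for u :: "complex vec"
    using conjugate_square_ge_0_vec[of u] by (auto simp: less_eq_complex_def complex_eq_iff)
  have nrm2: "nrm u * nrm u = u \<bullet>c u" for u
    using sq[of u] by (simp add: nrm_def flip: of_real_mult)
  have cnrm: "cnj (nrm u) = nrm u" for u by (simp add: nrm_def)
  define ws where "ws = map (\<lambda>u. (1 / nrm u) \<cdot>\<^sub>v u) us"
  have usc: "us ! i \<in> carrier_vec ?N" if "i < ?N" for i using us that by auto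
  have n0: "nrm (us ! i) \<noteq> 0" if "i < ?N" for i
    using corthogonalD[OF us(2), of i i] nrm2[of "us ! i"] that us(3) by auto
  have wsi: "ws ! i = (1 / nrm (us ! i)) \<cdot>\<^sub>v (us ! i)" if "i < ?N" for i
    using that us by (simp add: ws_def)
  have wsc: "ws ! i \<in> carrier_vec ?N" if "i < ?N" for i using usc[OF that] wsi[OF that] by simp
  have lws: "length ws = ?N" using us by (simp add: ws_def)
  have ip: "ws ! i \<bullet>c ws ! j = (if i = j then 1 else 0)" if "i < ?N" "j < ?N" for i j
  proof -
    have "ws ! i \<bullet>c ws ! j = 1 / nrm (us ! i) * (1 / nrm (us ! j)) * (us ! i \<bullet>c us ! j)"
      using usc[OF that(1)] carrier_vec_conjugate[OF usc[OF that(2)]]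
      by (simp add: wsi that conjugate_smult_vec cnrm smult_scalar_prod_distrib[of _ ?N]
          scalar_prod_smult_distrib[of _ ?N])
    moreover have "us ! i \<bullet>c us ! j = (if i = j then nrm (us ! i) * nrm (us ! j) else 0)"
      using corthogonalD[OF us(2), of i j] that us(3) nrm2[of "us ! j"] by auto
    ultimately show ?thesis
      using n0[OF that(1)] by (auto simp: field_simps)
  qed
  define W where "W = mat_of_cols ?N ws"
  have W: "W \<in> carrier_mat ?N ?N" unfolding W_def using lws by (metis mat_of_cols_carrier(1))
  have colW: "col W i = ws ! i" if "i < ?N" for i
    unfolding W_def using that lws wsc by (simp add: col_mat_of_cols)
  have rowW: "row (mat_adjoint W) i = conjugate (ws ! i)" if "i < ?N" for i
    using that W colW[OF that, symmetric]
    by (intro eq_vecI) (auto)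
  have cc: "conjugate x \<bullet> y = y \<bullet>c x" if "x \<in> carrier_vec ?N" "y \<in> carrier_vec ?N" for x y :: "complex vec"
    using that by (intro comm_scalar_prod[of _ ?N]) auto
  have unit: "mat_adjoint W * W = 1\<^sub>m ?N"
  proof (rule eq_matI)
    fix i j assume "i < dim_row (1\<^sub>m ?N :: complex mat)" "j < dim_col (1\<^sub>m ?N :: complex mat)"
    then show "(mat_adjoint W * W) $$ (i, j) = 1\<^sub>m ?N $$ (i, j)"
      using W by (simp add: rowW colW cc wsc ip)
  qed (use W in auto)
  define A' where "A' = mat_adjoint W * A * W"
  note mc = mult_carrier_mat[of _ ?N ?N _ ?N]
  note as = assoc_mult_mat[of _ ?N ?N _ ?N _ ?N]
  have Wa: "mat_adjoint W \<in> carrier_mat ?N ?N" using W by simp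
  have A': "A' \<in> carrier_mat ?N ?N" unfolding A'_def by (intro mc A W Wa)
  have hA': "mat_adjoint A' = A'"
  proof -
    have "mat_adjoint A' = mat_adjoint W * (mat_adjoint A * mat_adjoint (mat_adjoint W))"
      unfolding A'_def
      by (simp only: mat_adjoint_mult[OF mc[OF Wa A] W] mat_adjoint_mult[OF Wa A])
    then show ?thesis
      by (simp add: herm A'_def as[OF Wa A W])
  qed
  have w0: "ws ! 0 = (1 / nrm v) \<cdot>\<^sub>v v" using wsi[of 0] hdus us(3) by (metis hd_conv_nth length_0_conv nat.distinct(1) zero_less_Suc)
  have Aw0: "A *\<^sub>v (ws ! 0) = e \<cdot>\<^sub>v (ws ! 0)"
    unfolding w0 using A v by (simp add: mult_mat_vec smult_smult_assoc mult.commute)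
  have col0: "A' $$ (i, 0) = (if i = 0 then e else 0)" if "i < ?N" for i
  proof -
    have "A' $$ (i, 0) = row (mat_adjoint W) i \<bullet> col (A * W) 0"
      unfolding A'_def as[OF Wa A W] using A W that by simp
    also have "col (A * W) 0 = A *\<^sub>v (ws ! 0)"
      using col_mult2[OF A W, of 0] colW[of 0] by simp
    also have "row (mat_adjoint W) i \<bullet> (A *\<^sub>v (ws ! 0)) = e * (ws ! 0 \<bullet>c ws ! i)"
      using wsc[of 0] carrier_vec_conjugate[OF wsc[OF that]]
      by (simp add: that wsc Aw0 rowW cc smult_scalar_prod_distrib[of _ ?N])
    finally show ?thesis using ip[of 0 i] that by auto
  qed
  have hAij: "A' $$ (i, j) = cnj (A' $$ (j, i))" if "i < ?N" "j < ?N" for i j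
    using arg_cong[OF hA', of "\<lambda>M. M $$ (i, j)"] that A' by auto
  have "cnj e = e"
    using hAij[of 0 0, symmetric] col0[of 0] by simp
  then have ereal: "e = of_real (Re e)"
    by (simp add: complex_eq_iff)
  have row0: "A' $$ (0, j) = (if j = 0 then e else 0)" if "j < ?N" for j
    using hAij[of 0 j] col0[of j] that \<open>cnj e = e\<close> by (simp split: if_splits)
  define A3 where "A3 = mat n n (\<lambda>(i, j). A' $$ (Suc i, Suc j))"
  show thesis
  proof
    show "W \<in> carrier_mat ?N ?N" "mat_adjoint W * W = 1\<^sub>m ?N" "A3 \<in> carrier_mat n n"
      using W unit by (auto simp: A3_def)
    show "mat_adjoint A3 = A3"
      by (rule eq_matI) (use hAij[symmetric] in \<open>auto simp: A3_def\<close>)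
    show "mat_adjoint W * A * W = four_block_mat (mat 1 1 (\<lambda>_. complex_of_real (Re e))) (0\<^sub>m 1 n) (0\<^sub>m n 1) A3"
      unfolding A'_def[symmetric]
    proof (rule eq_matI, goal_cases)
      case (1 i j)
      then show ?case
        using col0[of i] row0[of j] A' ereal[symmetric]
        by (cases i; cases j) (auto simp: A3_def)
    qed (use A' in \<open>auto simp: A3_def\<close>)
  qed
qed

text \<open>Induction on the dimension: each deflation splits off one eigenvalue, and the unitary
  that diagonalises the remaining block is bordered by a 1.\<close>

theorem hermitian_diagonalization:
  fixes A :: "complex mat"
  assumes "A \<in> carrier_mat n n" and "mat_adjoint A = A"
  shows "\<exists>U d. U \<in> carrier_mat n n \<and> mat_adjoint U * U = 1\<^sub>m n \<and>
    mat_adjoint U * A * U = mat_diag n (\<lambda>i. complex_of_real (d i))"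
  using assms
proof (induction n arbitrary: A)
  case 0
  then show ?case
    by (intro exI[of _ "1\<^sub>m 0"] exI[of _ "\<lambda>_. 0"]) (auto intro!: eq_matI simp: mat_diag_def)
next
  case (Suc n)
  let ?N = "Suc n"
  obtain W e A3 where
    W: "W \<in> carrier_mat ?N ?N" "mat_adjoint W * W = 1\<^sub>m ?N" and
    A3: "A3 \<in> carrier_mat n n" "mat_adjoint A3 = A3" and
    WAW: "mat_adjoint W * A * W = four_block_mat (mat 1 1 (\<lambda>_. complex_of_real e)) (0\<^sub>m 1 n) (0\<^sub>m n 1) A3"
    by (rule hermitian_deflation[OF Suc.prems])
  from Suc.IH[OF A3] obtain V d where V: "V \<in> carrier_mat n n" "mat_adjoint V * V = 1\<^sub>m n"
    "mat_adjoint V * A3 * V = mat_diag n (\<lambda>i. complex_of_real (d i))" by auto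
  define F where "F = four_block_mat (1\<^sub>m 1) (0\<^sub>m 1 n) (0\<^sub>m n 1) V"
  have F: "F \<in> carrier_mat ?N ?N" unfolding F_def using four_block_carrier_mat[OF one_carrier_mat V(1), of 1] by simp
  have adj1: "mat_adjoint (1\<^sub>m 1) = (1\<^sub>m 1 :: complex mat)"
    "mat_adjoint (0\<^sub>m 1 n) = (0\<^sub>m n 1 :: complex mat)" "mat_adjoint (0\<^sub>m n 1) = (0\<^sub>m 1 n :: complex mat)"
    by (auto intro!: eq_matI)
  have aF: "mat_adjoint F = four_block_mat (1\<^sub>m 1) (0\<^sub>m 1 n) (0\<^sub>m n 1) (mat_adjoint V)"
    unfolding F_def by (subst mat_adjoint_four_block[of _ 1 1 _ n _ n]) (use V adj1 in auto)
  have V': "mat_adjoint V \<in> carrier_mat n n" using V by simp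
  have FF: "mat_adjoint F * F = 1\<^sub>m ?N"
    unfolding aF unfolding F_def
    by (subst mult_four_block_mat[of _ 1 1 _ n _ n _ _ 1 _ n])
      (use V V' in \<open>auto intro!: eq_matI\<close>)
  have "mat_adjoint F * (mat_adjoint W * A * W) =
      four_block_mat (mat 1 1 (\<lambda>_. complex_of_real e)) (0\<^sub>m 1 n) (0\<^sub>m n 1) (mat_adjoint V * A3)"
    unfolding WAW aF
    by (subst mult_four_block_mat[of _ 1 1 _ n _ n _ _ 1 _ n]) (use V V' A3 in auto)
  also have "\<dots> * F =
      four_block_mat (mat 1 1 (\<lambda>_. complex_of_real e)) (0\<^sub>m 1 n) (0\<^sub>m n 1) (mat_adjoint V * A3 * V)"
    unfolding F_def
    by (subst mult_four_block_mat[of _ 1 1 _ n _ n _ _ 1 _ n])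
      (use V(1) V' A3 mult_carrier_mat[OF V' A3(1)] in auto)
  also have "\<dots> = mat_diag ?N (\<lambda>i. complex_of_real (case_nat e d i))"
    unfolding V(3) by (intro eq_matI) (auto simp: mat_diag_def split: nat.splits)
  finally have FDF: "mat_adjoint F * (mat_adjoint W * A * W) * F = mat_diag ?N (\<lambda>i. complex_of_real (case_nat e d i))" .
  have Wa: "mat_adjoint W \<in> carrier_mat ?N ?N" and Fa: "mat_adjoint F \<in> carrier_mat ?N ?N"
    using W F by auto
  note mc = mult_carrier_mat[of _ ?N ?N _ ?N]
  note as = assoc_mult_mat[of _ ?N ?N _ ?N _ ?N]
  have WF: "W * F \<in> carrier_mat ?N ?N" by (intro mc W F)
  have aWF: "mat_adjoint (W * F) = mat_adjoint F * mat_adjoint W"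
    by (rule mat_adjoint_mult[OF W(1) F])
  have "mat_adjoint (W * F) * (W * F) = mat_adjoint F * (mat_adjoint W * W) * F"
    unfolding aWF as[OF Fa Wa WF] as[OF Fa mc[OF Wa W(1)] F] as[OF Wa W(1) F] ..
  moreover have "mat_adjoint (W * F) * A * (W * F) = mat_adjoint F * (mat_adjoint W * A * W) * F"
    unfolding aWF as[OF Fa Wa Suc.prems(1)] as[OF Fa mc[OF Wa Suc.prems(1)] WF]
      as[OF mc[OF Wa Suc.prems(1)] W(1) F, symmetric]
      as[OF Fa mc[OF mc[OF Wa Suc.prems(1)] W(1)] F] ..
  ultimately show ?case
    using WF W FF FDF right_mult_one_mat[OF Fa] by (intro exI[of _ "W * F"] exI[of _ "case_nat e d"]) (simp)
qed

text \<open>\<open>ev_neg\<close> is defined by root orders of the characteristic polynomial; for a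
  diagonal matrix this turns them into counts of diagonal indices.\<close>

lemma order_prod_linear:
  fixes f :: "'b \<Rightarrow> 'a::idom"
  assumes "finite I"
  shows "Polynomial.order c (\<Prod>i\<in>I. [:- f i, 1:]) = card {i \<in> I. f i = c}"
  using assms
proof (induction I rule: finite_induct)
  case (insert x I)
  have ne: "[:- f x, 1:] * (\<Prod>i\<in>I. [:- f i, 1:]) \<noteq> 0"
    using insert.hyps(1) by (simp add: prod_zero_iff del: mult_pCons_left)
  have "{i \<in> insert x I. f i = c} = (if f x = c then insert x {i \<in> I. f i = c} else {i \<in> I. f i = c})"
    by auto
  then show ?case
    using insert order_mult[OF ne, of c] order_power_n_n[of c 1]
    by (simp add: order_0I del: mult_pCons_left)
qed auto

text \<open>The form in which the spectral theorem is used below: index sums instead of matrix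
  products, with \<open>u _ i\<close> the \<open>i\<close>-th eigenvector. Similar matrices share
  their characteristic polynomial, so \<open>ev_neg\<close> can be read off the diagonal
  form.\<close>

lemma hermitian_spectral:
  fixes A :: "complex mat"
  assumes A: "A \<in> carrier_mat n n" and herm: "hermitian_mat A"
  obtains d :: "nat \<Rightarrow> real" and u :: "nat \<Rightarrow> nat \<Rightarrow> complex" where
    "\<And>a b. a < n \<Longrightarrow> b < n \<Longrightarrow> A $$ (a, b) = (\<Sum>i<n. complex_of_real (d i) * u a i * cnj (u b i))"
    "\<And>i j. i < n \<Longrightarrow> j < n \<Longrightarrow> (\<Sum>a<n. cnj (u a i) * u a j) = (if i = j then 1 else 0)"
    "ev_neg A = card {i \<in> {..<n}. d i < 0}"
proof -
  from hermitian_diagonalization[OF A] herm obtain U d where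
    U: "U \<in> carrier_mat n n" and UU: "mat_adjoint U * U = 1\<^sub>m n" and
    D: "mat_adjoint U * A * U = mat_diag n (\<lambda>i. complex_of_real (d i))"
    by (auto simp: hermitian_mat_def)
  let ?D = "mat_diag n (\<lambda>i. complex_of_real (d i))"
  have U': "mat_adjoint U \<in> carrier_mat n n" using U by simp
  have UU': "U * mat_adjoint U = 1\<^sub>m n" by (rule mat_mult_left_right_inverse[OF U' U UU])
  note as = assoc_mult_mat[of _ n n _ n _ n]
  note mc = mult_carrier_mat[of _ n n _ n]
  have AUD: "A = U * ?D * mat_adjoint U"
  proof -
    have "U * ?D * mat_adjoint U = (U * mat_adjoint U) * A * (U * mat_adjoint U)"
      unfolding D[symmetric]
      unfolding as[OF U' A U] as[OF U mc[OF U' mc[OF A U]] U'] as[OF U' mc[OF A U] U'] as[OF A U U']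
        as[OF U U' A] as[OF U mc[OF U' A] mc[OF U U']] as[OF U' A mc[OF U U']] ..
    then show ?thesis using A by (simp add: UU')
  qed
  have "similar_mat_wit A ?D U (mat_adjoint U)"
    by (rule similar_mat_witI[OF UU' UU AUD A _ U U']) simp
  then have "char_poly A = char_poly ?D"
    by (intro char_poly_similar) (auto simp: similar_mat_def)
  also have "\<dots> = (\<Prod>a\<leftarrow>diag_mat ?D. [:- a, 1:])"
    by (rule char_poly_upper_triangular[of _ n]) (auto simp: mat_diag_def)
  also have "diag_mat ?D = map (\<lambda>i. complex_of_real (d i)) [0..<n]"
    by (auto simp: diag_mat_def mat_diag_def)
  also have "(\<Prod>a\<leftarrow>map (\<lambda>i. complex_of_real (d i)) [0..<n]. [:- a, 1:]) = (\<Prod>i<n. [:- complex_of_real (d i), 1:])"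
    by (simp add: o_def prod.distinct_set_conv_list[symmetric] atLeast0LessThan)
  finally have cp: "char_poly A = (\<Prod>i<n. [:- complex_of_real (d i), 1:])" .
  have ord: "Polynomial.order (complex_of_real l) (char_poly A) = card {i \<in> {..<n}. d i = l}" for l
    unfolding cp by (subst order_prod_linear) auto
  have "{l. l < 0 \<and> eigenvalue A (complex_of_real l)} = d ` {i \<in> {..<n}. d i < 0}"
    unfolding eigenvalue_root_char_poly[OF A] cp by (auto simp: poly_prod)
  then have "ev_neg A = (\<Sum>l \<in> d ` {i \<in> {..<n}. d i < 0}. card {i \<in> {..<n}. d i = l})"
    by (simp add: ev_neg_def ord)
  also have "\<dots> = (\<Sum>l \<in> d ` {i \<in> {..<n}. d i < 0}. card {i \<in> {i \<in> {..<n}. d i < 0}. d i = l})"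
    by (intro sum.cong refl arg_cong[of _ _ card]) auto
  \<comment> \<open>Counting indices fibre by fibre of \<open>d\<close> collects the multiplicities
    of the distinct negative eigenvalues.\<close>
  also have "\<dots> = card {i \<in> {..<n}. d i < 0}"
    using sum.image_gen[of "{i \<in> {..<n}. d i < 0}" "\<lambda>_. 1::nat" d] by simp
  finally have ev: "ev_neg A = card {i \<in> {..<n}. d i < 0}" .
  show thesis
  proof (rule that[OF _ _ ev])
    fix a b assume ab: "a < n" "b < n"
    have UD: "U * ?D \<in> carrier_mat n n" using U by (intro mc) auto
    have "(U * ?D * mat_adjoint U) $$ (a, b) = (\<Sum>i<n. (U * ?D) $$ (a, i) * cnj (U $$ (b, i)))"
      using ab U carrier_matD[OF UD] by (simp add: scalar_prod_def atLeast0LessThan)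
    also have "\<dots> = (\<Sum>i<n. of_real (d i) * U $$ (a, i) * cnj (U $$ (b, i)))"
      using ab by (intro sum.cong refl) (simp add: mat_diag_mult_right[OF U])
    finally have "(U * ?D * mat_adjoint U) $$ (a, b) = (\<Sum>i<n. of_real (d i) * U $$ (a, i) * cnj (U $$ (b, i)))" .
    then show "A $$ (a, b) = (\<Sum>i<n. of_real (d i) * (\<lambda>a i. U $$ (a, i)) a i * cnj ((\<lambda>a i. U $$ (a, i)) b i))"
      using AUD by simp
  next
    fix i j assume ij: "i < n" "j < n"
    have "(mat_adjoint U * U) $$ (i, j) = (\<Sum>a<n. cnj (U $$ (a, i)) * U $$ (a, j))"
      using ij U by (auto simp: scalar_prod_def atLeast0LessThan intro!: sum.cong)
    then show "(\<Sum>a<n. cnj ((\<lambda>a i. U $$ (a, i)) a i) * (\<lambda>a i. U $$ (a, i)) a j) = (if i = j then 1 else 0)"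
      using UU ij by simp
  qed
qed

section \<open>Negative eigenvalues counted by test vectors\<close>

lemma underdetermined_system:
  fixes c :: "'s \<Rightarrow> nat \<Rightarrow> 'a::field"
  assumes "finite S" "card S < m"
  obtains y where "\<exists>i<m. y i \<noteq> 0" "\<And>s. s \<in> S \<Longrightarrow> (\<Sum>i<m. c s i * y i) = 0"
proof -
  obtain e where e: "bij_betw e {..<card S} S"
    using bij_betw_from_nat_into_finite[OF assms(1)] by blast
  \<comment> \<open>Zero rows pad the system to a square one. Since \<open>card S < m\<close> the
    last row is zero, so the transpose kills the last unit vector and the determinant
    vanishes.\<close>
  define M where "M = mat m m (\<lambda>(r, i). if r < card S then c (e r) i else 0)"
  have M: "M \<in> carrier_mat m m" by (simp add: M_def)
  have "det (transpose_mat M) = 0"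
  proof -
    have "transpose_mat M *\<^sub>v unit_vec m (m - 1) = 0\<^sub>v m"
      using assms(2) by (intro eq_vecI) (auto simp: M_def row_transpose)
    moreover have "unit_vec m (m - 1) \<noteq> (0\<^sub>v m :: 'a vec)"
      using assms(2) by simp
    ultimately show ?thesis
      using det_0_iff_vec_prod_zero_field[of "transpose_mat M" m] M
      by (meson transpose_carrier_mat unit_vec_carrier)
  qed
  then have "det M = 0" using det_transpose[OF M] by simp
  then obtain v where v: "v \<in> carrier_vec m" "v \<noteq> 0\<^sub>v m" "M *\<^sub>v v = 0\<^sub>v m"
    using det_0_iff_vec_prod_zero_field[OF M] by auto
  show thesis
  proof (rule that[of "\<lambda>i. v $ i"])
    show "\<exists>i<m. v $ i \<noteq> 0" using v(1,2) by (auto simp: vec_eq_iff)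
  next
    fix s assume "s \<in> S"
    then obtain r where r: "r < card S" "s = e r" using e by (auto simp: bij_betw_def)
    have "(M *\<^sub>v v) $ r = (\<Sum>i<m. c s i * v $ i)"
      using r assms(2) v(1) by (auto simp: M_def scalar_prod_def atLeast0LessThan intro!: sum.cong)
    then show "(\<Sum>i<m. c s i * v $ i) = 0" using v(3) r assms(2) by simp
  qed
qed

lemma cnj_mult_self: "cnj z * z = complex_of_real ((cmod z)\<^sup>2)"
  by (metis complex_norm_square mult.commute of_real_power)

text \<open>One half of the law of inertia. With fewer than \<open>m\<close> negative eigenvalues, a
  nonzero combination of the \<open>Y i\<close> would be orthogonal to all their eigenvectors, and
  there the form is nonnegative. The strict inequality for every nonzero \<open>y\<close> also
  encodes linear independence of the \<open>Y i\<close>.\<close>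

lemma ev_neg_ge:
  fixes A :: "complex mat" and Y :: "nat \<Rightarrow> nat \<Rightarrow> complex"
  assumes A: "A \<in> carrier_mat n n" and herm: "hermitian_mat A"
    and neg: "\<And>y. \<exists>i<m. y i \<noteq> 0 \<Longrightarrow>
      Re (\<Sum>a<n. \<Sum>b<n. cnj (\<Sum>i<m. y i * Y i a) * A $$ (a, b) * (\<Sum>i<m. y i * Y i b)) < 0"
  shows "m \<le> ev_neg A"
proof (rule ccontr)
  assume "\<not> m \<le> ev_neg A"
  obtain d u where u: "\<And>a b. a < n \<Longrightarrow> b < n \<Longrightarrow> A $$ (a, b) = (\<Sum>i<n. complex_of_real (d i) * u a i * cnj (u b i))"
    and "\<And>i j. i < n \<Longrightarrow> j < n \<Longrightarrow> (\<Sum>a<n. cnj (u a i) * u a j) = (if i = j then 1 else 0)"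
    and ev: "ev_neg A = card {i \<in> {..<n}. d i < 0}"
    using hermitian_spectral[OF A herm] by blast
  have "finite {i \<in> {..<n}. d i < 0}" "card {i \<in> {..<n}. d i < 0} < m"
    using \<open>\<not> m \<le> ev_neg A\<close> ev by auto
  then obtain y where y: "\<exists>i<m. y i \<noteq> 0"
    "\<And>s. s \<in> {i \<in> {..<n}. d i < 0} \<Longrightarrow> (\<Sum>i<m. (\<Sum>a<n. cnj (u a s) * Y i a) * y i) = 0"
    by (rule underdetermined_system[where c = "\<lambda>s i. \<Sum>a<n. cnj (u a s) * Y i a"]) blast
  define v where "v a = (\<Sum>i<m. y i * Y i a)" for a
  define p where "p s = (\<Sum>a<n. cnj (u a s) * v a)" for s
  have "(\<Sum>i<m. (\<Sum>a<n. cnj (u a s) * Y i a) * y i) = p s" for s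
    unfolding p_def v_def sum_distrib_left sum_distrib_right
    by (subst sum.swap) (simp add: mult_ac)
  then have p0: "p s = 0" if "s < n" "d s < 0" for s
    using y(2)[of s] that by simp
  have "(\<Sum>a<n. \<Sum>b<n. cnj (v a) * A $$ (a, b) * v b) =
      (\<Sum>a<n. \<Sum>b<n. \<Sum>s<n. of_real (d s) * (cnj (v a) * u a s) * (cnj (u b s) * v b))"
    by (intro sum.cong refl) (simp add: u sum_distrib_left sum_distrib_right mult_ac)
  also have "\<dots> = (\<Sum>s<n. \<Sum>a<n. \<Sum>b<n. of_real (d s) * (cnj (v a) * u a s) * (cnj (u b s) * v b))"
    by (rule trans[OF sum.cong[OF refl sum.swap] sum.swap])
  also have "\<dots> = (\<Sum>s<n. of_real (d s) * (cnj (p s) * p s))"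
    by (intro sum.cong refl)
      (simp add: p_def sum_distrib_left sum_distrib_right mult_ac)
  also have "\<dots> = of_real (\<Sum>s<n. d s * (cmod (p s))\<^sup>2)"
    by (simp add: cnj_mult_self)
  finally have "Re (\<Sum>a<n. \<Sum>b<n. cnj (v a) * A $$ (a, b) * v b) = (\<Sum>s<n. d s * (cmod (p s))\<^sup>2)"
    by simp
  moreover have "\<dots> \<ge> 0"
    by (intro sum_nonneg) (metis lessThan_iff linorder_not_le mult_nonneg_nonneg mult_zero_right norm_zero p0 zero_le_power2 zero_power2)
  ultimately show False
    using neg[OF y(1)] unfolding v_def by simp
qed

text \<open>The opposite direction to \<open>ev_neg_ge\<close>: orthonormal eigenvectors of the
  negative eigenvalues have a negative diagonal Gram matrix. This supplies the negative directions
  of the Pick matrix.\<close>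

lemma ev_neg_vectors:
  fixes A :: "complex mat"
  assumes A: "A \<in> carrier_mat n n" and herm: "hermitian_mat A"
  obtains q :: "nat \<Rightarrow> nat \<Rightarrow> complex" and \<gamma> :: "nat \<Rightarrow> real" where
    "\<forall>r<ev_neg A. \<gamma> r < 0"
    "\<forall>r<ev_neg A. \<forall>t<ev_neg A.
      (\<Sum>a<n. \<Sum>b<n. cnj (q r a) * A $$ (a, b) * q t b) = (if r = t then complex_of_real (\<gamma> r) else 0)"
proof -
  obtain d u where u: "\<And>a b. a < n \<Longrightarrow> b < n \<Longrightarrow> A $$ (a, b) = (\<Sum>i<n. complex_of_real (d i) * u a i * cnj (u b i))"
    and on: "\<And>i j. i < n \<Longrightarrow> j < n \<Longrightarrow> (\<Sum>a<n. cnj (u a i) * u a j) = (if i = j then 1 else 0)"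
    and ev: "ev_neg A = card {i \<in> {..<n}. d i < 0}"
    using hermitian_spectral[OF A herm] by blast
  obtain e where e: "bij_betw e {..<card {i \<in> {..<n}. d i < 0}} {i \<in> {..<n}. d i < 0}"
    using bij_betw_from_nat_into_finite[of "{i \<in> {..<n}. d i < 0}"] by auto
  have er: "e r < n" "d (e r) < 0" if "r < ev_neg A" for r
    using e that ev by (auto simp: bij_betw_def)
  have einj: "e r = e t \<longleftrightarrow> r = t" if "r < ev_neg A" "t < ev_neg A" for r t
    using e that ev by (auto simp: bij_betw_def inj_on_def)
  have Au: "(\<Sum>b<n. A $$ (a, b) * u b i) = of_real (d i) * u a i" if "a < n" "i < n" for a i
  proof -
    have "(\<Sum>b<n. A $$ (a, b) * u b i) = (\<Sum>b<n. \<Sum>j<n. of_real (d j) * u a j * (cnj (u b j) * u b i))"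
      using that by (intro sum.cong refl) (simp add: u sum_distrib_left sum_distrib_right mult_ac)
    also have "\<dots> = (\<Sum>j<n. of_real (d j) * u a j * (\<Sum>b<n. cnj (u b j) * u b i))"
      by (subst sum.swap) (simp add: sum_distrib_left)
    also have "\<dots> = (\<Sum>j<n. if j = i then of_real (d i) * u a i else 0)"
      using that by (intro sum.cong refl) (simp add: on)
    finally show ?thesis using that by simp
  qed
  show thesis
  proof (rule that[of "\<lambda>r. d (e r)" "\<lambda>r a. u a (e r)"])
    show "\<forall>r<ev_neg A. d (e r) < 0" using er by blast
    show "\<forall>r<ev_neg A. \<forall>t<ev_neg A. (\<Sum>a<n. \<Sum>b<n. cnj (u a (e r)) * A $$ (a, b) * u b (e t)) =
        (if r = t then complex_of_real (d (e r)) else 0)"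
    proof (intro allI impI)
      fix r t assume rt: "r < ev_neg A" "t < ev_neg A"
      have "(\<Sum>a<n. \<Sum>b<n. cnj (u a (e r)) * A $$ (a, b) * u b (e t)) =
          (\<Sum>a<n. cnj (u a (e r)) * (\<Sum>b<n. A $$ (a, b) * u b (e t)))"
        by (simp add: sum_distrib_left mult_ac)
      also have "\<dots> = (\<Sum>a<n. cnj (u a (e r)) * (of_real (d (e t)) * u a (e t)))"
        using er rt by (intro sum.cong refl) (simp add: Au)
      also have "\<dots> = of_real (d (e t)) * (\<Sum>a<n. cnj (u a (e r)) * u a (e t))"
        by (simp add: sum_distrib_left mult_ac)
      finally show "(\<Sum>a<n. \<Sum>b<n. cnj (u a (e r)) * A $$ (a, b) * u b (e t)) =
          (if r = t then complex_of_real (d (e r)) else 0)"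
        using er rt by (simp add: on einj)
    qed
  qed
qed

lemma sum_swap4:
  "(\<Sum>a\<in>A. \<Sum>b\<in>B. \<Sum>i\<in>I. \<Sum>j\<in>J. f a b i j) =
    (\<Sum>i\<in>I. \<Sum>j\<in>J. \<Sum>a\<in>A. \<Sum>b\<in>B. f a b i j)"
proof -
  have "(\<Sum>a\<in>A. \<Sum>b\<in>B. \<Sum>i\<in>I. \<Sum>j\<in>J. f a b i j) =
      (\<Sum>a\<in>A. \<Sum>i\<in>I. \<Sum>j\<in>J. \<Sum>b\<in>B. f a b i j)"
    by (rule sum.cong[OF refl], subst sum.swap, rule sum.cong[OF refl], rule sum.swap)
  also have "\<dots> = (\<Sum>i\<in>I. \<Sum>a\<in>A. \<Sum>j\<in>J. \<Sum>b\<in>B. f a b i j)"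
    by (rule sum.swap)
  also have "\<dots> = (\<Sum>i\<in>I. \<Sum>j\<in>J. \<Sum>a\<in>A. \<Sum>b\<in>B. f a b i j)"
    by (rule sum.cong[OF refl], rule sum.swap)
  finally show ?thesis .
qed

text \<open>The Gram matrix that matters later is diagonal only in a limit, so an error has to be
  tolerated. By 2ab <= a^2 + b^2 an entrywise error \<open>\<delta>\<close> changes the form by at
  most \<open>m * \<delta>\<close> times the squared norm of \<open>y\<close>, which the margin in
  \<open>neg\<close> absorbs.\<close>

lemma ev_neg_ge_almost_diagonal:
  fixes A :: "complex mat" and Y :: "nat \<Rightarrow> nat \<Rightarrow> complex" and \<gamma> :: "nat \<Rightarrow> real"
  assumes A: "A \<in> carrier_mat n n" and herm: "hermitian_mat A"
    and gram: "\<And>i j. i < m \<Longrightarrow> j < m \<Longrightarrow>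
      cmod ((\<Sum>a<n. \<Sum>b<n. cnj (Y i a) * A $$ (a, b) * Y j b) - (if i = j then of_real (\<gamma> i) else 0)) \<le> \<delta>"
    and neg: "\<And>i. i < m \<Longrightarrow> \<gamma> i + m * \<delta> < 0"
  shows "m \<le> ev_neg A"
proof (rule ev_neg_ge[OF A herm, of m Y])
  fix y :: "nat \<Rightarrow> complex"
  assume y: "\<exists>i<m. y i \<noteq> 0"
  define G where "G i j = (\<Sum>a<n. \<Sum>b<n. cnj (Y i a) * A $$ (a, b) * Y j b)" for i j
  define E where "E i j = G i j - (if i = j then of_real (\<gamma> i) else 0)" for i j
  have E: "cmod (E i j) \<le> \<delta>" if "i < m" "j < m" for i j
    using gram[OF that] by (simp add: E_def G_def)
  have "(\<Sum>a<n. \<Sum>b<n. cnj (\<Sum>i<m. y i * Y i a) * A $$ (a, b) * (\<Sum>j<m. y j * Y j b)) =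
      (\<Sum>a<n. \<Sum>b<n. \<Sum>i<m. \<Sum>j<m. cnj (y i) * y j * (cnj (Y i a) * A $$ (a, b) * Y j b))"
    by (simp add: sum_distrib_left sum_distrib_right mult_ac)
  also have "\<dots> = (\<Sum>i<m. \<Sum>j<m. \<Sum>a<n. \<Sum>b<n. cnj (y i) * y j * (cnj (Y i a) * A $$ (a, b) * Y j b))"
    by (rule sum_swap4)
  also have "\<dots> = (\<Sum>i<m. \<Sum>j<m. cnj (y i) * y j * G i j)"
    by (simp add: G_def sum_distrib_left)
  also have "\<dots> = (\<Sum>i<m. \<Sum>j<m. (if j = i then of_real (\<gamma> i) * (cnj (y i) * y i) else 0) + cnj (y i) * y j * E i j)"
    by (intro sum.cong refl) (auto simp: E_def algebra_simps)
  also have "\<dots> = of_real (\<Sum>i<m. \<gamma> i * (cmod (y i))\<^sup>2) + (\<Sum>i<m. \<Sum>j<m. cnj (y i) * y j * E i j)"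
    by (simp add: sum.distrib cnj_mult_self)
  finally have eq: "(\<Sum>a<n. \<Sum>b<n. cnj (\<Sum>i<m. y i * Y i a) * A $$ (a, b) * (\<Sum>j<m. y j * Y j b)) =
      of_real (\<Sum>i<m. \<gamma> i * (cmod (y i))\<^sup>2) + (\<Sum>i<m. \<Sum>j<m. cnj (y i) * y j * E i j)" .
  have "Re (\<Sum>i<m. \<Sum>j<m. cnj (y i) * y j * E i j) \<le> cmod (\<Sum>i<m. \<Sum>j<m. cnj (y i) * y j * E i j)"
    by (rule complex_Re_le_cmod)
  also have "\<dots> \<le> (\<Sum>i<m. \<Sum>j<m. cmod (cnj (y i) * y j * E i j))"
    by (intro order_trans[OF norm_sum] sum_mono norm_sum)
  also have "\<dots> \<le> (\<Sum>i<m. \<Sum>j<m. \<delta> / 2 * ((cmod (y i))\<^sup>2 + (cmod (y j))\<^sup>2))"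
  proof (intro sum_mono)
    fix i j assume ij: "i \<in> {..<m}" "j \<in> {..<m}"
    have "0 \<le> \<delta>" using E[of i j] ij by (meson lessThan_iff norm_ge_zero order_trans)
    have "cmod (cnj (y i) * y j * E i j) \<le> cmod (y i) * cmod (y j) * \<delta>"
      using E[of i j] ij by (simp add: norm_mult mult_left_mono)
    also have "\<dots> \<le> ((cmod (y i))\<^sup>2 + (cmod (y j))\<^sup>2) / 2 * \<delta>"
      using \<open>0 \<le> \<delta>\<close> sum_squares_bound[of "cmod (y i)" "cmod (y j)"] by (intro mult_right_mono) auto
    finally show "cmod (cnj (y i) * y j * E i j) \<le> \<delta> / 2 * ((cmod (y i))\<^sup>2 + (cmod (y j))\<^sup>2)"
      by (simp add: mult_ac)
  qed
  also have "\<dots> = (\<Sum>i<m. m * \<delta> * (cmod (y i))\<^sup>2)"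
    by (simp add: distrib_left sum.distrib sum_distrib_left[symmetric] sum_divide_distrib[symmetric] algebra_simps)
  finally have "Re (\<Sum>a<n. \<Sum>b<n. cnj (\<Sum>i<m. y i * Y i a) * A $$ (a, b) * (\<Sum>j<m. y j * Y j b))
      \<le> (\<Sum>i<m. (\<gamma> i + m * \<delta>) * (cmod (y i))\<^sup>2)"
    unfolding eq by (simp add: distrib_right sum.distrib)
  also have "\<dots> < (\<Sum>i<m. 0)"
  proof (rule sum_strict_mono_ex1)
    show "\<forall>i\<in>{..<m}. (\<gamma> i + m * \<delta>) * (cmod (y i))\<^sup>2 \<le> 0"
      using less_imp_le[OF neg] by (auto intro!: mult_nonpos_nonneg)
    show "\<exists>i\<in>{..<m}. (\<gamma> i + m * \<delta>) * (cmod (y i))\<^sup>2 < 0"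
    proof -
      obtain i where i: "i < m" "y i \<noteq> 0" using y by blast
      have "(\<gamma> i + m * \<delta>) * (cmod (y i))\<^sup>2 < 0"
        using neg[OF i(1)] i(2) by (intro mult_neg_pos) auto
      then show ?thesis using i(1) by auto
    qed
  qed auto
  finally show "Re (\<Sum>a<n. \<Sum>b<n. cnj (\<Sum>i<m. y i * Y i a) * A $$ (a, b) * (\<Sum>j<m. y j * Y j b)) < 0"
    by simp
qed

section \<open>The Pick matrix and its inverse\<close>

text \<open>What the product of \<open>toeplitz_T\<close> and \<open>binom_B\<close> reduces to,
  extended to all indices so that its recursion has no range conditions. The inner test treats
  coefficients of index below \<open>k\<close> as 0; \<open>\<tau> 0\<close> enters only through the
  prefactor.\<close>

definition pick_entry :: "nat \<Rightarrow> (nat \<Rightarrow> complex) \<Rightarrow> nat \<Rightarrow> nat \<Rightarrow> complex" where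
  "pick_entry k \<tau> i j = cnj (\<tau> 0) * (- 1) ^ j *
     (\<Sum>l\<le>j. of_nat (j choose l) * (if k \<le> i + j + 1 - l then \<tau> (i + j + 1 - l) else 0))"

lemma pick_P_carrier [simp]: "pick_P k \<tau> \<in> carrier_mat k k"
  unfolding pick_P_def toeplitz_T_def binom_B_def
  by (intro smult_carrier_mat mult_carrier_mat[of _ k k]) auto

lemma mat_mult_index:
  assumes "A \<in> carrier_mat n m" "B \<in> carrier_mat m l" "i < n" "j < l"
  shows "(A * B) $$ (i, j) = (\<Sum>c<m. A $$ (i, c) * B $$ (c, j))"
  using assms by (simp add: scalar_prod_def atLeast0LessThan)

lemma mat_adjoint_one [simp]: "mat_adjoint (1\<^sub>m n) = (1\<^sub>m n :: complex mat)"
  by (rule eq_matI) auto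

lemma pick_P_index:
  assumes "i < k" "j < k"
  shows "pick_P k \<tau> $$ (i, j) = pick_entry k \<tau> i j"
proof -
  have "pick_P k \<tau> $$ (i, j) = cnj (\<tau> 0) * (\<Sum>l<k. (if l \<le> i then \<tau> (k + i - l) else 0) *
      (if k \<le> l + j + 1 then (- 1) ^ j * of_nat (j choose (l + j + 1 - k)) else 0))"
    using assms by (simp add: pick_P_def toeplitz_T_def binom_B_def scalar_prod_def atLeast0LessThan)
  also have "(\<Sum>l<k. (if l \<le> i then \<tau> (k + i - l) else 0) *
      (if k \<le> l + j + 1 then (- 1) ^ j * of_nat (j choose (l + j + 1 - k)) else 0)) =
    (\<Sum>l\<in>{l\<in>{..<k}. k \<le> l + j + 1}. (if l \<le> i then \<tau> (k + i - l) else 0) *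
      ((- 1) ^ j * of_nat (j choose (l + j + 1 - k))))"
    by (intro sum.mono_neutral_cong_right) auto
  \<comment> \<open>The lower binomial index \<open>l + j + 1 - k\<close> becomes the summation
    index; the triangularity test of \<open>toeplitz_T\<close> then reads
    \<open>k \<le> i + j + 1 - l\<close>.\<close>
  also have "\<dots> = (\<Sum>l\<le>j. (- 1) ^ j * (of_nat (j choose l) * (if k \<le> i + j + 1 - l then \<tau> (i + j + 1 - l) else 0)))"
    using assms(1,2)
    by (intro sum.reindex_bij_witness[where i = "\<lambda>l. l + k - 1 - j" and j = "\<lambda>l. l + j + 1 - k"])
      (auto simp: algebra_simps)
  finally show ?thesis
    by (simp add: pick_entry_def sum_distrib_left mult_ac)
qed

lemma sum_choose_Suc:
  fixes a :: "nat \<Rightarrow> 'a::comm_semiring_1"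
  shows "(\<Sum>l\<le>Suc j. of_nat (Suc j choose l) * a l) =
    (\<Sum>l\<le>j. of_nat (j choose l) * a l) + (\<Sum>l\<le>j. of_nat (j choose l) * a (Suc l))"
proof -
  have "(\<Sum>l\<le>Suc j. of_nat (Suc j choose l) * a l) =
      a 0 + (\<Sum>l\<le>j. of_nat (j choose Suc l) * a (Suc l)) + (\<Sum>l\<le>j. of_nat (j choose l) * a (Suc l))"
    by (subst sum.atMost_Suc_shift) (simp add: sum.distrib algebra_simps)
  also have "a 0 + (\<Sum>l\<le>j. of_nat (j choose Suc l) * a (Suc l)) = (\<Sum>l\<le>Suc j. of_nat (j choose l) * a l)"
    by (subst sum.atMost_Suc_shift) simp
  also have "\<dots> = (\<Sum>l\<le>j. of_nat (j choose l) * a l)"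
    by (simp add: binomial_eq_0)
  finally show ?thesis .
qed

text \<open>Pascal's rule in the column index. Together with the zeros above the antidiagonal this
  is the invariance of the Pick matrix under congruence by a unipotent shift.\<close>

lemma pick_entry_rec:
  "pick_entry k \<tau> (Suc i) j + pick_entry k \<tau> i (Suc j) + pick_entry k \<tau> i j = 0"
proof -
  define a where "a m = (if k \<le> m then \<tau> m else 0)" for m
  have p: "pick_entry k \<tau> i j = cnj (\<tau> 0) * (- 1) ^ j * (\<Sum>l\<le>j. of_nat (j choose l) * a (i + j + 1 - l))" for i j
    by (simp only: pick_entry_def a_def)
  have "(\<Sum>l\<le>Suc j. of_nat (Suc j choose l) * a (i + Suc j + 1 - l)) =
      (\<Sum>l\<le>j. of_nat (j choose l) * a (Suc i + j + 1 - l)) + (\<Sum>l\<le>j. of_nat (j choose l) * a (i + j + 1 - l))"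
    by (subst sum_choose_Suc) simp
  then show ?thesis
    unfolding p by (simp add: algebra_simps del: sum.atMost_Suc)
qed

lemma pick_entry_eq_0:
  assumes "i + j + 1 < k"
  shows "pick_entry k \<tau> i j = 0"
proof -
  have "\<not> k \<le> i + j + 1 - l" for l using assms by linarith
  then show ?thesis by (simp only: pick_entry_def if_False) simp
qed

lemma pick_entry_antidiagonal:
  assumes "i + j + 1 = k"
  shows "pick_entry k \<tau> i j = cnj (\<tau> 0) * (- 1) ^ j * \<tau> k"
proof -
  have "(\<Sum>l\<le>j. of_nat (j choose l) * (if k \<le> i + j + 1 - l then \<tau> (i + j + 1 - l) else 0)) =
      (\<Sum>l\<le>j. if l = 0 then \<tau> k else 0)"
    using assms by (intro sum.cong refl) auto
  then show ?thesis by (simp add: pick_entry_def)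
qed

text \<open>The matrix is zero above the antidiagonal and has nonzero multiples of
  \<open>\<tau> k\<close> on it. Read from the top, row \<open>i\<close> forces entry
  \<open>k - 1 - i\<close> of a kernel vector to vanish.\<close>

lemma det_pick_P_ne_0:
  assumes "\<tau> 0 \<noteq> 0" "\<tau> k \<noteq> 0"
  shows "det (pick_P k \<tau>) \<noteq> 0"
proof
  assume "det (pick_P k \<tau>) = 0"
  then obtain v where v: "v \<in> carrier_vec k" "v \<noteq> 0\<^sub>v k" "pick_P k \<tau> *\<^sub>v v = 0\<^sub>v k"
    using det_0_iff_vec_prod_zero_field[OF pick_P_carrier] by blast
  have "v $ (k - 1 - i) = 0" if "i < k" for i
    using that
  proof (induction i rule: less_induct)
    case (less i)
    have "0 = (pick_P k \<tau> *\<^sub>v v) $ i" using v(3) less.prems by simp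
    also have "\<dots> = (\<Sum>j<k. pick_entry k \<tau> i j * v $ j)"
      using less.prems v(1) carrier_matD[OF pick_P_carrier[of k \<tau>]]
      by (simp add: scalar_prod_def pick_P_index atLeast0LessThan)
    also have "\<dots> = (\<Sum>j<k. if j = k - 1 - i then pick_entry k \<tau> i j * v $ j else 0)"
    proof (intro sum.cong refl)
      fix j assume "j \<in> {..<k}"
      then consider "i + j + 1 < k" | "j = k - 1 - i" | "k - 1 - j < i" "j = k - 1 - (k - 1 - j)"
        using less.prems by fastforce
      then show "pick_entry k \<tau> i j * v $ j = (if j = k - 1 - i then pick_entry k \<tau> i j * v $ j else 0)"
        using less.IH[of "k - 1 - j"] less.prems by cases (auto simp: pick_entry_eq_0)
    qed
    also have "\<dots> = pick_entry k \<tau> i (k - 1 - i) * v $ (k - 1 - i)"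
      using less.prems by simp
    finally show ?case
      using assms less.prems by (simp add: pick_entry_antidiagonal)
  qed
  then have "v $ i = 0" if "i < k" for i
    using that by (metis diff_diff_cancel diff_less_Suc Suc_pred less_Suc_eq_le less_imp_Suc_add zero_less_Suc diff_Suc_1)
  then show False using v by (auto simp: vec_eq_iff)
qed

section \<open>The inverse Pick matrix and the kernel identity for Theta\<close>

lemma mat_inverse_exists:
  fixes A :: "'a::field mat"
  assumes "A \<in> carrier_mat n n" "det A \<noteq> 0"
  obtains X where "mat_inverse A = Some X" "X \<in> carrier_mat n n" "A * X = 1\<^sub>m n" "X * A = 1\<^sub>m n"
proof (cases "mat_inverse A")
  case None
  then show ?thesis
    using mat_inverse(1)[OF assms(1) None, of "()"] det_non_zero_imp_unit[OF assms, of "()"] by blast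
next
  case (Some X)
  then show ?thesis using mat_inverse(2)[OF assms(1) Some] that by blast
qed

lemma hermitian_inverse:
  assumes A: "A \<in> carrier_mat n n" and herm: "hermitian_mat A"
    and X: "X \<in> carrier_mat n n" "A * X = 1\<^sub>m n" "X * A = 1\<^sub>m n"
  shows "hermitian_mat X"
proof -
  have 1: "mat_adjoint X * A = 1\<^sub>m n"
    using mat_adjoint_mult[OF A X(1)] herm X(2) by (simp add: hermitian_mat_def)
  have X': "mat_adjoint X \<in> carrier_mat n n" using X by simp
  have "mat_adjoint X = mat_adjoint X * (A * X)" using X X' by simp
  also have "\<dots> = (mat_adjoint X * A) * X" using assoc_mult_mat[OF X' A X(1)] by simp
  finally show ?thesis using 1 X by (simp add: hermitian_mat_def)
qed

text \<open>The shift structure \<open>M P M\<^sup>T = P\<close> with \<open>M = 1 + N\<close>, \<open>N\<close> the lower shift, passes to \<open>M\<^sup>T P\<inverse> M = P\<inverse>\<close>.\<close>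

lemma pick_inverse_rec:
  fixes X :: "complex mat"
  assumes X: "X \<in> carrier_mat k k" "pick_P k \<tau> * X = 1\<^sub>m k" "X * pick_P k \<tau> = 1\<^sub>m k"
    and x_def: "\<And>i j. x i j = (if i < k \<and> j < k then X $$ (i, j) else 0)"
    and ij: "i < k" "j < k"
  shows "x (Suc i) j + x i (Suc j) + x (Suc i) (Suc j) = 0"
proof -
  define M :: "complex mat" where
    "M = mat k k (\<lambda>(i, j). (if i = j then 1 else 0) + (if i = Suc j then 1 else 0))"
  let ?P = "pick_P k \<tau>" and ?Mt = "transpose_mat M"
  have M: "M \<in> carrier_mat k k" and Mt: "?Mt \<in> carrier_mat k k" by (simp_all add: M_def)
  note mc = mult_carrier_mat[of _ k k _ k] and as = assoc_mult_mat[of _ k k _ k _ k]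
  have dP: "dim_row ?P = k" "dim_col ?P = k" using carrier_matD[OF pick_P_carrier] by auto
  have MPM: "M * ?P * ?Mt = ?P"
  proof (rule eq_matI)
    fix a b assume "a < dim_row ?P" "b < dim_col ?P"
    then have ab: "a < k" "b < k" by (simp_all add: dP)
    let ?p = "pick_entry k \<tau>"
    have MP: "(M * ?P) $$ (a, c) = ?p a c + (case a of 0 \<Rightarrow> 0 | Suc a' \<Rightarrow> ?p a' c)" if "c < k" for c
      unfolding mat_mult_index[OF M pick_P_carrier ab(1) that]
      using that ab
      by (auto simp: M_def pick_P_index distrib_right sum.distrib
          if_distrib[of "\<lambda>x. x * _"] cong: if_cong split: nat.splits)
    have "(M * ?P * ?Mt) $$ (a, b) = (\<Sum>c<k. (M * ?P) $$ (a, c) * M $$ (b, c))"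
      unfolding mat_mult_index[OF mc[OF M pick_P_carrier] Mt ab]
      using ab M by (intro sum.cong refl) (simp del: index_mult_mat(1))
    also have "\<dots> = (\<Sum>c<k. (if c = b then (M * ?P) $$ (a, c) else 0) + (if b = Suc c then (M * ?P) $$ (a, c) else 0))"
      using ab by (intro sum.cong refl) (auto simp: M_def distrib_left simp del: index_mult_mat(1))
    also have "\<dots> = (M * ?P) $$ (a, b) + (case b of 0 \<Rightarrow> 0 | Suc b' \<Rightarrow> (M * ?P) $$ (a, b'))"
      using ab by (auto simp: sum.distrib split: nat.splits simp del: index_mult_mat(1))
    \<comment> \<open>In the first row and column the shifted entry lies above the antidiagonal and
      is 0; elsewhere the recursion removes the three shifted entries.\<close>
    also have "\<dots> = ?p a b"
      using ab pick_entry_rec[of k \<tau> "a - 1" "b - 1"]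
      by (auto simp: MP pick_entry_eq_0 split: nat.splits simp del: index_mult_mat(1)) (simp add: algebra_simps)
    finally show "(M * ?P * ?Mt) $$ (a, b) = ?P $$ (a, b)" using ab by (simp add: pick_P_index)
  qed (use M in \<open>auto simp: dP\<close>)
  have P: "?P \<in> carrier_mat k k" by simp
  have "M * (?P * ?Mt * X) = M * ?P * ?Mt * X"
    using M Mt P X(1) by (metis as mc)
  then have "M * (?P * ?Mt * X) = 1\<^sub>m k" using MPM X by simp
  \<comment> \<open>A right inverse of a square matrix is a left inverse; this moves
    \<open>M\<close> to the far right, where \<open>X\<close> can cancel \<open>?P\<close> on the
    left.\<close>
  then have inv: "?P * ?Mt * X * M = 1\<^sub>m k"
    by (rule mat_mult_left_right_inverse[OF M mc[OF mc[OF P Mt] X(1)]])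
  have "X = X * (?P * ?Mt * X * M)" using inv X by simp
  also have "\<dots> = (X * ?P) * (?Mt * X * M)"
    using M Mt P X(1) by (metis as mc)
  also have "\<dots> = ?Mt * X * M" using X(3) left_mult_one_mat[OF mc[OF mc[OF Mt X(1)] M]] by simp
  finally have XM: "X = ?Mt * X * M" .
  have MX: "(?Mt * X) $$ (i, c) = x i c + x (Suc i) c" if "c < k" for c
    unfolding mat_mult_index[OF Mt X(1) ij(1) that]
    using that ij
    by (auto simp: M_def distrib_right sum.distrib x_def
        if_distrib[of "\<lambda>x. x * _"] cong: if_cong)
  have "X $$ (i, j) = (\<Sum>c<k. (?Mt * X) $$ (i, c) * M $$ (c, j))"
    by (subst XM) (rule mat_mult_index[OF mc[OF Mt X(1)] M ij])
  also have "\<dots> = (\<Sum>c<k. (if c = j then (?Mt * X) $$ (i, c) else 0) + (if c = Suc j then (?Mt * X) $$ (i, c) else 0))"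
    using ij by (intro sum.cong refl) (auto simp: M_def distrib_left simp del: index_mult_mat(1))
  also have "\<dots> = (x i j + x (Suc i) j) + (x i (Suc j) + x (Suc i) (Suc j))"
    using ij by (auto simp: sum.distrib MX x_def simp del: index_mult_mat(1))
  finally have "x i j = (x i j + x (Suc i) j) + (x i (Suc j) + x (Suc i) (Suc j))"
    using ij x_def[of i j] by simp
  then show ?thesis by (simp add: algebra_simps)
qed

text \<open>Multiplication by \<open>1 + t + t'\<close> makes the left side of \<open>rec\<close>
  the coefficient of \<open>t ^ Suc i * t' ^ Suc j\<close>, so only monomials in a single variable
  remain. With \<open>t = z / (1 - z)\<close> and \<open>t' = cnj (w / (1 - w))\<close> the factor
  is \<open>(1 - z * cnj w) / ((1 - z) * cnj (1 - w))\<close>.\<close>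

lemma kernel_separation:
  fixes x :: "nat \<Rightarrow> nat \<Rightarrow> complex"
  assumes rec: "\<And>i j. i < k \<Longrightarrow> j < k \<Longrightarrow> x (Suc i) j + x i (Suc j) + x (Suc i) (Suc j) = 0"
    and zero: "\<And>i j. i \<ge> k \<or> j \<ge> k \<Longrightarrow> x i j = 0"
  obtains f g where "\<And>t t'. (1 + t + t') * (\<Sum>i<k. \<Sum>j<k. x i j * t ^ i * t' ^ j) = f t + g t'"
proof
  fix t t' :: complex
  define S where "S = (\<Sum>i<k. \<Sum>j<k. x i j * t ^ i * t' ^ j)"
  define c0 where "c0 j = (\<Sum>i<k. x i j * t ^ i)" for j
  \<comment> \<open>The added terms are 0; the longer ranges allow the three sums to be shifted
    against each other.\<close>
  have S': "S = (\<Sum>i<Suc k. \<Sum>j<Suc k. x i j * t ^ i * t' ^ j)"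
    by (simp add: S_def zero)
  have tS: "t * S = (\<Sum>i<k. \<Sum>j<Suc k. x i j * t ^ Suc i * t' ^ j)"
    by (simp add: S_def zero sum_distrib_left mult_ac)
  have t'S: "t' * S = (\<Sum>i<Suc k. \<Sum>j<k. x i j * t ^ i * t' ^ Suc j)"
    by (simp add: S_def zero sum_distrib_left mult_ac)
  have "S + t * S + t' * S =
      (\<Sum>j<Suc k. x 0 j * t' ^ j) + (\<Sum>j<k. x 0 j * t' ^ Suc j)
      + (\<Sum>i<k. x (Suc i) 0 * t ^ Suc i) + (\<Sum>i<k. x i 0 * t ^ Suc i)
      + (\<Sum>i<k. \<Sum>j<k. (x (Suc i) (Suc j) + x i (Suc j) + x (Suc i) j) * t ^ Suc i * t' ^ Suc j)"
    unfolding tS t'S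
    by (subst S') (simp add: sum.lessThan_Suc_shift sum.distrib algebra_simps del: sum.lessThan_Suc)
  also have "(\<Sum>i<k. \<Sum>j<k. (x (Suc i) (Suc j) + x i (Suc j) + x (Suc i) j) * t ^ Suc i * t' ^ Suc j) = 0"
  proof (intro sum.neutral ballI)
    fix i j assume "i \<in> {..<k}" "j \<in> {..<k}"
    then have "x (Suc i) (Suc j) + x i (Suc j) + x (Suc i) j = 0"
      using rec[of i j] by (simp add: algebra_simps)
    then show "(x (Suc i) (Suc j) + x i (Suc j) + x (Suc i) j) * t ^ Suc i * t' ^ Suc j = 0"
      by (metis mult_zero_left)
  qed
  finally have "(1 + t + t') * S =
      ((\<Sum>i<k. x (Suc i) 0 * t ^ Suc i) + (\<Sum>i<k. x i 0 * t ^ Suc i))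
      + ((\<Sum>j<Suc k. x 0 j * t' ^ j) + (\<Sum>j<k. x 0 j * t' ^ Suc j))"
    by (simp add: distrib_right add_ac del: sum.lessThan_Suc)
  then show "(1 + t + t') * (\<Sum>i<k. \<Sum>j<k. x i j * t ^ i * t' ^ j) =
      ((\<Sum>i<k. x (Suc i) 0 * t ^ Suc i) + (\<Sum>i<k. x i 0 * t ^ Suc i))
      + ((\<Sum>j<Suc k. x 0 j * t' ^ j) + (\<Sum>j<k. x 0 j * t' ^ Suc j))"
    unfolding S_def .
qed

text \<open>An entry of \<open>row_R\<close> as a scalar function. With
  \<open>t = z / (1 - z)\<close> it is \<open>(1 + t) * t ^ i\<close>, which yields power sums in
  the kernel and Vandermonde matrices at the nodes.\<close>

definition R_fun :: "nat \<Rightarrow> complex \<Rightarrow> complex" where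
  "R_fun i z = z ^ i / (1 - z) ^ (i + 1)"

text \<open>\<open>\<phi>\<close> is the scalar function in \<open>\<Theta> = I - \<phi> u u\<^sup>* J\<close>.\<close>

definition theta_phi :: "nat \<Rightarrow> (nat \<Rightarrow> complex) \<Rightarrow> complex \<Rightarrow> complex \<Rightarrow> complex" where
  "theta_phi k \<tau> z0 z = (1 - z * cnj z0) * poly_p k \<tau> z0 z / (1 - z) ^ k"

text \<open>Write r(z, w) for the double sum. By \<open>kernel_separation\<close> the product (1 - z
  cnj(w)) r(z, w) is a function of z plus a function of w, while \<open>theta_phi\<close> is that
  product at w = \<open>z0\<close>. Adding the products at (z, z0) and (z0, w) gives those at (z, w)
  and (z0, z0), and the last one vanishes because \<open>z0\<close> is unimodular. Hermitian
  symmetry of \<open>X\<close> identifies the conjugate of \<open>theta_phi\<close> with the product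
  at (z0, w).\<close>

lemma theta_phi_kernel:
  assumes "\<tau> 0 \<noteq> 0" "\<tau> k \<noteq> 0" and herm: "hermitian_mat (pick_P k \<tau>)"
    and z0: "norm z0 = 1" "z0 \<noteq> 1"
  obtains X where "X \<in> carrier_mat k k" "hermitian_mat X"
    "pick_P k \<tau> * X = 1\<^sub>m k" "X * pick_P k \<tau> = 1\<^sub>m k"
    "\<forall>z w. z \<noteq> 1 \<longrightarrow> w \<noteq> 1 \<longrightarrow> theta_phi k \<tau> z0 z + cnj (theta_phi k \<tau> z0 w) =
      (1 - z * cnj w) * (\<Sum>i<k. \<Sum>j<k. R_fun i z * X $$ (i, j) * cnj (R_fun j w))"
proof -
  obtain X where inv: "mat_inverse (pick_P k \<tau>) = Some X" and X: "X \<in> carrier_mat k k"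
    "pick_P k \<tau> * X = 1\<^sub>m k" "X * pick_P k \<tau> = 1\<^sub>m k"
    by (rule mat_inverse_exists[OF pick_P_carrier det_pick_P_ne_0[OF assms(1,2)]])
  have hX: "hermitian_mat X" by (rule hermitian_inverse[OF pick_P_carrier herm X])
  have Xc: "cnj (X $$ (i, j)) = X $$ (j, i)" if "i < k" "j < k" for i j
    using that X(1) hX mat_adjoint_index[of j X i] by (simp add: hermitian_mat_def)
  define x where "x i j = (if i < k \<and> j < k then X $$ (i, j) else 0)" for i j
  define \<rho> where "\<rho> t t' = (\<Sum>i<k. \<Sum>j<k. x i j * t ^ i * t' ^ j)" for t t'
  obtain f g where fg: "\<And>t t'. (1 + t + t') * \<rho> t t' = f t + g t'"
    unfolding \<rho>_def
    by (rule kernel_separation[of k x, OF pick_inverse_rec[OF X x_def]]) (auto simp: x_def)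
  define r where "r z w = (\<Sum>i<k. \<Sum>j<k. R_fun i z * X $$ (i, j) * cnj (R_fun j w))" for z w
  have r_rho: "r z w = \<rho> (z / (1 - z)) (cnj (w / (1 - w))) / ((1 - z) * cnj (1 - w))" for z w
    unfolding r_def R_fun_def \<rho>_def sum_divide_distrib
    by (intro sum.cong refl) (simp add: x_def power_divide mult_ac)
  have rr: "(1 - z * cnj w) * r z w = f (z / (1 - z)) + g (cnj (w / (1 - w)))" if "z \<noteq> 1" "w \<noteq> 1" for z w
  proof -
    have "cnj w \<noteq> 1" using that(2) by (metis complex_cnj_cnj complex_cnj_one)
    then have eq: "(1 - z * cnj w) / ((1 - z) * cnj (1 - w)) = 1 + z / (1 - z) + cnj (w / (1 - w))"
      using that by (simp add: field_simps)
    have "(1 - z * cnj w) * r z w =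
        (1 - z * cnj w) / ((1 - z) * cnj (1 - w)) * \<rho> (z / (1 - z)) (cnj (w / (1 - w)))"
      by (simp add: r_rho)
    then show ?thesis unfolding eq fg .
  qed
  have phi: "theta_phi k \<tau> z0 z = (1 - z * cnj z0) * r z z0" if "z \<noteq> 1" for z
  proof -
    have R: "row_R k z \<in> carrier_mat 1 k" "row_R k z0 \<in> carrier_mat 1 k" by (auto simp: row_R_def)
    have R': "mat_adjoint (row_R k z0) \<in> carrier_mat k 1" using R by simp
    have RX: "(row_R k z * X) $$ (0, j) = (\<Sum>i<k. z ^ i / (1 - z) ^ (i + 1) * X $$ (i, j))" if "j < k" for j
      using mat_mult_index[OF R(1) X(1) _ that, of 0] by (simp add: row_R_def)
    have Ra: "mat_adjoint (row_R k z0) $$ (j, 0) = cnj (z0 ^ j / (1 - z0) ^ (j + 1))" if "j < k" for j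
      using that by (simp add: row_R_def)
    have "(row_R k z * X * mat_adjoint (row_R k z0)) $$ (0, 0) =
        (\<Sum>j<k. \<Sum>i<k. z ^ i / (1 - z) ^ (i + 1) * X $$ (i, j) * cnj (z0 ^ j / (1 - z0) ^ (j + 1)))"
    proof -
      have "(row_R k z * X * mat_adjoint (row_R k z0)) $$ (0, 0) =
          (\<Sum>j<k. (row_R k z * X) $$ (0, j) * mat_adjoint (row_R k z0) $$ (j, 0))"
        by (rule mat_mult_index[OF mult_carrier_mat[OF R(1) X(1)] R']) auto
      also have "\<dots> = (\<Sum>j<k. \<Sum>i<k. z ^ i / (1 - z) ^ (i + 1) * X $$ (i, j) * cnj (z0 ^ j / (1 - z0) ^ (j + 1)))"
        by (intro sum.cong refl) (simp only: lessThan_iff RX Ra sum_distrib_right)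
      finally show ?thesis .
    qed
    also have "\<dots> = r z z0" unfolding r_def R_fun_def by (rule sum.swap)
    finally show ?thesis using that by (simp add: theta_phi_def poly_p_def inv)
  qed
  have rc: "cnj (r z w) = r w z" for z w
    unfolding r_def cnj_sum
    by (subst sum.swap, intro sum.cong refl) (simp add: Xc mult_ac)
  have z0': "z0 * cnj z0 = 1" using z0 by (simp add: complex_norm_square[symmetric])
  show thesis
  proof (rule that[OF X(1) hX X(2,3)], fold r_def, intro allI impI)
    fix z w :: complex assume zw: "z \<noteq> 1" "w \<noteq> 1"
    have "theta_phi k \<tau> z0 z + cnj (theta_phi k \<tau> z0 w) = (1 - z * cnj z0) * r z z0 + (1 - z0 * cnj w) * r z0 w"
      using zw by (simp add: phi rc mult_ac)
    also have "\<dots> = (1 - z * cnj w) * r z w + (1 - z0 * cnj z0) * r z0 z0"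
      using zw z0 by (simp add: rr)
    finally show "theta_phi k \<tau> z0 z + cnj (theta_phi k \<tau> z0 w) = (1 - z * cnj w) * r z w"
      using z0' by simp
  qed
qed

section \<open>Positivity of the Caratheodory kernel\<close>

text \<open>A kernel vector of the Vandermonde matrix would list the coefficients of a nonzero
  polynomial of degree below \<open>k\<close> with \<open>k\<close> distinct roots. Row
  \<open>m\<close> of \<open>D\<close> holds node weights that extract the \<open>m\<close>-th
  coefficient.\<close>

lemma vandermonde_left_inverse:
  fixes x :: "nat \<Rightarrow> 'a::field"
  assumes inj: "inj_on x {..<k}"
  obtains D where "\<And>m n. m < k \<Longrightarrow> n < k \<Longrightarrow> (\<Sum>a<k. D m a * x a ^ n) = (if m = n then 1 else 0)"
proof -
  define W where "W = mat k k (\<lambda>(a, n). x a ^ n)"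
  have W: "W \<in> carrier_mat k k" by (simp add: W_def)
  have "det W \<noteq> 0"
  proof
    assume "det W = 0"
    then obtain v where v: "v \<in> carrier_vec k" "v \<noteq> 0\<^sub>v k" "W *\<^sub>v v = 0\<^sub>v k"
      using det_0_iff_vec_prod_zero_field[OF W] by blast
    define p where "p = (\<Sum>n<k. Polynomial.monom (v $ n) n)"
    have coeff: "coeff p n = (if n < k then v $ n else 0)" for n
      by (simp add: p_def coeff_sum if_distrib cong: if_cong)
    have p0: "p \<noteq> 0" using v(1,2) coeff by (auto simp: vec_eq_iff poly_eq_iff)
    have "k > 0" using p0 by (cases k) (auto simp: p_def)
    then have deg: "degree p < k" using degree_le[of "k - 1" p] coeff by fastforce
    have "poly p (x a) = 0" if "a < k" for a
    proof -
      have "(W *\<^sub>v v) $ a = (\<Sum>n<k. x a ^ n * v $ n)"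
        using that v(1) by (simp add: W_def scalar_prod_def atLeast0LessThan)
      then show ?thesis using v(3) that by (simp add: p_def poly_sum poly_monom mult.commute)
    qed
    then have "card (x ` {..<k}) \<le> card {y. poly p y = 0}"
      by (intro card_mono poly_roots_finite[OF p0]) auto
    also have "\<dots> \<le> degree p" by (rule poly_roots_degree[OF p0])
    finally show False using deg inj by (simp add: card_image)
  qed
  then obtain D where D: "D \<in> carrier_mat k k" "D * W = 1\<^sub>m k"
    using mat_inverse_exists[OF W] by metis
  show thesis
  proof (rule that[of "\<lambda>m a. D $$ (m, a)"])
    fix m n assume "m < k" "n < k"
    then show "(\<Sum>a<k. D $$ (m, a) * x a ^ n) = (if m = n then 1 else 0)"
      using mat_mult_index[OF D(1) W, of m n] D(2) by (simp add: W_def)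
  qed
qed

lemma sum_lessThan_add:
  fixes f :: "nat \<Rightarrow> 'a::comm_monoid_add"
  shows "(\<Sum>a<k + N. f a) = (\<Sum>a<k. f a) + (\<Sum>l<N. f (k + l))"
  by (induction N) (simp_all add: add_ac)

lemma kernel_mat_hermitian: "hermitian_mat (kernel_mat s n w)"
  unfolding hermitian_mat_def
  by (rule eq_matI) (auto simp: kernel_mat_def schur_kernel_def mult.commute)

definition carath_kernel :: "(complex \<Rightarrow> complex) \<Rightarrow> complex \<Rightarrow> complex \<Rightarrow> complex" where
  "carath_kernel F z w = (F z + cnj (F w)) / (1 - z * cnj w)"

section \<open>Limits of the Caratheodory kernel along radial nodes\<close>

lemma filterlim_radial_node:
  fixes c :: real
  assumes "c > 0"
  shows "filterlim (\<lambda>L. L * c / (1 + L * c)) (at_left 1) at_top"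
proof -
  have "((\<lambda>L. L * c / (1 + L * c)) \<longlongrightarrow> 1) at_top"
    using assms by real_asymp
  moreover have "\<forall>\<^sub>F L in at_top. L * c / (1 + L * c) < 1"
    using eventually_gt_at_top[of 0]
  proof eventually_elim
    case (elim L)
    then have "L * c > 0" using assms by simp
    then show ?case by (simp add: field_simps)
  qed
  ultimately show ?thesis by (rule tendsto_imp_filterlim_at_left)
qed

text \<open>For 0 < u, v < 1 both 1 - u and 1 - v are at most 1 - uv, so the kernel at (u, v) is
  bounded by |F(u)| / (1 - u) + |F(v)| / (1 - v). This is where the rate o(1 - r) enters; the two
  points may approach 1 at unrelated speeds. With one argument fixed the denominator has a nonzero
  limit.\<close>

lemma carath_kernel_tendsto:
  fixes F :: "complex \<Rightarrow> complex" and u v :: "real \<Rightarrow> real"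
  assumes F: "((\<lambda>r. F (of_real r) / of_real (1 - r)) \<longlongrightarrow> 0) (at_left 1)"
    and u: "filterlim u (at_left 1) at_top" and v: "filterlim v (at_left 1) at_top"
  shows "((\<lambda>L. carath_kernel F (of_real (u L)) (of_real (v L))) \<longlongrightarrow> 0) at_top"
    and "z \<noteq> 1 \<Longrightarrow> ((\<lambda>L. carath_kernel F z (of_real (v L))) \<longlongrightarrow> F z / (1 - z)) at_top"
    and "z \<noteq> 1 \<Longrightarrow> ((\<lambda>L. carath_kernel F (of_real (v L)) z) \<longlongrightarrow> cnj (F z) / (1 - cnj z)) at_top"
proof -
  have ev01: "\<forall>\<^sub>F r in at_left (1::real). 0 < r \<and> r < 1"
    using eventually_at_left_real[of 0 1] by (auto elim: eventually_mono)
  have "((\<lambda>r. F (of_real r) / of_real (1 - r) * of_real (1 - r)) \<longlongrightarrow> 0 * of_real (1 - 1)) (at_left (1::real))"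
    by (intro tendsto_mult F tendsto_intros)
  moreover have "\<forall>\<^sub>F r in at_left (1::real). F (of_real r) / of_real (1 - r) * of_real (1 - r) = F (of_real r)"
    using ev01 by eventually_elim auto
  ultimately have F0: "((\<lambda>r. F (of_real r)) \<longlongrightarrow> 0) (at_left (1::real))"
    by (simp add: filterlim_cong)
  have Fv: "((\<lambda>L. F (of_real (v L))) \<longlongrightarrow> 0) at_top"
    by (rule filterlim_compose[OF F0 v])
  have v1: "(v \<longlongrightarrow> 1) at_top"
    using v by (rule filterlim_mono) (auto simp: at_within_le_nhds)
  have vc: "((\<lambda>L. complex_of_real (v L)) \<longlongrightarrow> 1) at_top"
    using tendsto_of_real[OF v1, where ?'a = complex] by simp
  show "((\<lambda>L. carath_kernel F z (of_real (v L))) \<longlongrightarrow> F z / (1 - z)) at_top" if "z \<noteq> 1"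
  proof -
    have "((\<lambda>L. (F z + cnj (F (of_real (v L)))) / (1 - z * cnj (of_real (v L)))) \<longlongrightarrow> (F z + cnj 0) / (1 - z * cnj 1)) at_top"
      by (intro tendsto_intros Fv vc) (use that in auto)
    then show ?thesis by (simp add: carath_kernel_def)
  qed
  show "((\<lambda>L. carath_kernel F (of_real (v L)) z) \<longlongrightarrow> cnj (F z) / (1 - cnj z)) at_top" if "z \<noteq> 1"
  proof -
    have "cnj z \<noteq> 1" using that by (metis complex_cnj_cnj complex_cnj_one)
    then have "((\<lambda>L. (F (of_real (v L)) + cnj (F z)) / (1 - of_real (v L) * cnj z)) \<longlongrightarrow> (0 + cnj (F z)) / (1 - 1 * cnj z)) at_top"
      by (intro tendsto_intros Fv vc) auto
    then show ?thesis by (simp add: carath_kernel_def)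
  qed
  have lim: "((\<lambda>L. cmod (F (of_real (u L)) / of_real (1 - u L)) + cmod (F (of_real (v L)) / of_real (1 - v L))) \<longlongrightarrow> 0) at_top"
    using tendsto_add[OF tendsto_norm[OF filterlim_compose[OF F u]] tendsto_norm[OF filterlim_compose[OF F v]]]
    by simp
  have "\<forall>\<^sub>F L in at_top. 0 < u L \<and> u L < 1" "\<forall>\<^sub>F L in at_top. 0 < v L \<and> v L < 1"
    using ev01 u v by (auto simp: filterlim_iff)
  then have "\<forall>\<^sub>F L in at_top. cmod (carath_kernel F (of_real (u L)) (of_real (v L)))
      \<le> cmod (F (of_real (u L)) / of_real (1 - u L)) + cmod (F (of_real (v L)) / of_real (1 - v L))"
  proof eventually_elim
    case (elim L)
    let ?u = "u L" and ?v = "v L"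
    have uv: "?u * ?v \<le> ?u" "?u * ?v \<le> ?v" "?u * ?v < 1"
      using elim by (auto simp: mult_le_cancel_left2 mult_le_cancel_right2 intro: order_le_less_trans[of _ ?u])
    have "carath_kernel F (of_real ?u) (of_real ?v) =
        F (of_real ?u) / of_real (1 - ?u * ?v) + cnj (F (of_real ?v)) / of_real (1 - ?u * ?v)"
      by (simp add: carath_kernel_def add_divide_distrib)
    then have "cmod (carath_kernel F (of_real ?u) (of_real ?v)) \<le>
        cmod (F (of_real ?u)) / (1 - ?u * ?v) + cmod (F (of_real ?v)) / (1 - ?u * ?v)"
      using norm_triangle_ineq uv(3)
      by (metis (no_types, lifting) abs_of_pos complex_mod_cnj diff_gt_0_iff_gt norm_divide norm_of_real)
    also have "\<dots> \<le> cmod (F (of_real ?u)) / (1 - ?u) + cmod (F (of_real ?v)) / (1 - ?v)"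
      using uv elim by (intro add_mono divide_left_mono mult_pos_pos) auto
    also have "\<dots> = cmod (F (of_real ?u) / of_real (1 - ?u)) + cmod (F (of_real ?v) / of_real (1 - ?v))"
      using elim by (simp only: norm_divide norm_of_real) simp
    finally show ?case .
  qed
  then show "((\<lambda>L. carath_kernel F (of_real (u L)) (of_real (v L))) \<longlongrightarrow> 0) at_top"
    by (rule Lim_null_comparison[OF _ lim])
qed

lemma R_fun_node:
  fixes t :: real
  assumes "t > 0"
  shows "R_fun i (of_real (t / (1 + t))) = of_real ((1 + t) * t ^ i)"
proof -
  have "1 - t / (1 + t) = 1 / (1 + t)" using assms by (simp add: field_simps)
  then have "R_fun i (of_real (t / (1 + t))) = of_real ((t / (1 + t)) ^ i / (1 / (1 + t)) ^ (i + 1))"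
    unfolding R_fun_def by (metis of_real_1 of_real_diff of_real_divide of_real_power)
  also have "(t / (1 + t)) ^ i / (1 / (1 + t)) ^ (i + 1) = (1 + t) * t ^ i"
    using assms by (simp add: power_divide)
  finally show ?thesis .
qed

text \<open>Negative squares are counted on \<open>P\<close>, but the kernel contains its inverse
  \<open>X\<close>. Taking \<open>q\<close> as \<open>P\<close> applied to a vector
  \<open>q0\<close> turns the form of \<open>X\<close> into that of \<open>P X P = P\<close>, so the
  negative vectors of \<open>P\<close> carry over with the same Gram matrix.\<close>

lemma inverse_negative_vectors:
  fixes P :: "complex mat"
  assumes P: "P \<in> carrier_mat k k" and herm: "hermitian_mat P"
    and X: "X \<in> carrier_mat k k" "X * P = 1\<^sub>m k"
  obtains \<gamma> :: "nat \<Rightarrow> real" and q :: "nat \<Rightarrow> nat \<Rightarrow> complex" where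
    "\<forall>r<ev_neg P. \<gamma> r < 0"
    "\<forall>r<ev_neg P. \<forall>t<ev_neg P.
      (\<Sum>i<k. \<Sum>j<k. cnj (q r i) * X $$ (i, j) * q t j) = (if r = t then complex_of_real (\<gamma> r) else 0)"
proof -
  obtain q0 \<gamma> where neg: "\<forall>r<ev_neg P. \<gamma> r < (0::real)"
    and gram: "\<forall>r<ev_neg P. \<forall>t<ev_neg P.
      (\<Sum>a<k. \<Sum>b<k. cnj (q0 r a) * P $$ (a, b) * q0 t b) = (if r = t then complex_of_real (\<gamma> r) else 0)"
    by (rule ev_neg_vectors[OF P herm])
  define q where "q r i = (\<Sum>a<k. P $$ (i, a) * q0 r a)" for r i
  have XP: "(\<Sum>j<k. X $$ (i, j) * P $$ (j, b)) = (if i = b then 1 else 0)" if "i < k" "b < k" for i b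
    using mat_mult_index[OF X(1) P that] that X(2) by simp
  have Pc: "cnj (P $$ (i, a)) = P $$ (a, i)" if "i < k" "a < k" for i a
    using that P herm mat_adjoint_index[of a P i] by (simp add: hermitian_mat_def)
  have Xq: "(\<Sum>j<k. X $$ (i, j) * q t j) = q0 t i" if "i < k" for i t
  proof -
    have "(\<Sum>j<k. X $$ (i, j) * q t j) = (\<Sum>b<k. (\<Sum>j<k. X $$ (i, j) * P $$ (j, b)) * q0 t b)"
      unfolding q_def sum_distrib_left sum_distrib_right by (subst sum.swap) (simp add: mult_ac)
    also have "\<dots> = (\<Sum>b<k. if b = i then q0 t b else 0)"
      using that by (intro sum.cong refl) (simp add: XP)
    finally show ?thesis using that by simp
  qed
  have "(\<Sum>i<k. \<Sum>j<k. cnj (q r i) * X $$ (i, j) * q t j) = (\<Sum>a<k. \<Sum>b<k. cnj (q0 r a) * P $$ (a, b) * q0 t b)" for r t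
  proof -
    have "(\<Sum>i<k. \<Sum>j<k. cnj (q r i) * X $$ (i, j) * q t j) = (\<Sum>i<k. cnj (q r i) * (\<Sum>j<k. X $$ (i, j) * q t j))"
      by (simp add: sum_distrib_left mult_ac)
    also have "\<dots> = (\<Sum>i<k. \<Sum>a<k. cnj (q0 r a) * P $$ (a, i) * q0 t i)"
    proof (intro sum.cong refl)
      fix i assume i: "i \<in> {..<k}"
      then have "cnj (q r i) = (\<Sum>a<k. cnj (q0 r a) * P $$ (a, i))"
        by (simp add: q_def Pc mult.commute)
      then show "cnj (q r i) * (\<Sum>j<k. X $$ (i, j) * q t j) = (\<Sum>a<k. cnj (q0 r a) * P $$ (a, i) * q0 t i)"
        using i by (simp add: Xq sum_distrib_right)
    qed
    also have "\<dots> = (\<Sum>a<k. \<Sum>b<k. cnj (q0 r a) * P $$ (a, b) * q0 t b)"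
      by (rule sum.swap)
    finally show ?thesis .
  qed
  then show thesis using that[of \<gamma> q] neg gram by simp
qed

lemma small_perturbation_exists:
  fixes \<gamma> :: "nat \<Rightarrow> real" and m :: nat
  assumes "\<And>i. i < m \<Longrightarrow> \<gamma> i < 0"
  obtains \<delta> :: real where "\<delta> > 0" "\<forall>i<m. \<gamma> i + m * \<delta> < 0"
proof -
  have "\<forall>\<^sub>F \<delta> in at_right (0::real). \<forall>i\<in>{..<m}. \<gamma> i + m * \<delta> < 0"
  proof (intro eventually_ball_finite ballI)
    fix i assume i: "i \<in> {..<m}"
    have "((\<lambda>\<delta>::real. \<gamma> i + m * \<delta>) \<longlongrightarrow> \<gamma> i + real m * 0) (at_right 0)" by (intro tendsto_intros)
    then show "\<forall>\<^sub>F \<delta> in at_right (0::real). \<gamma> i + m * \<delta> < 0"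
      using assms i by (intro order_tendstoD(2)) auto
  qed simp
  then have "\<forall>\<^sub>F \<delta> in at_right (0::real). \<delta> > 0 \<and> (\<forall>i\<in>{..<m}. \<gamma> i + m * \<delta> < 0)"
    by (intro eventually_conj eventually_at_right_less)
  from eventually_happens'[OF trivial_limit_at_right_real this]
  show thesis using that by auto
qed

text \<open>
  Against a negative vector for the \<open>F\<close> summand, the nodes \<open>\<zeta> = t / (1 + t)\<close> with \<open>t = L (a + 1)\<close>, \<open>a < k\<close>, are
  weighted with an inverse Vandermonde matrix: there \<open>R\<^sub>n(\<zeta>) = (1 + t) t\<^sup>n\<close>, so every vector of \<open>\<complex>\<^sup>k\<close> is a
  value of the functional \<open>e \<mapsto> \<Sum>\<^sub>a cnj(R(w\<^sub>a)) e\<^sub>a\<close>. This adds the \<open>\<kappa>\<close> negative vectors of \<open>X\<close> and removes the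
  \<open>X\<close> part of the given vector. As \<open>L \<rightarrow> \<infinity>\<close> the weights tend to 0 and the Gram matrix tends to a negative
  diagonal matrix of size \<open>\<kappa> + 1\<close>.
\<close>

theorem carath_kernel_psd:
  fixes s F :: "complex \<Rightarrow> complex" and X :: "complex mat" and z c :: "nat \<Rightarrow> complex"
  assumes s: "s \<in> gen_schur \<kappa>"
    and q_neg: "\<And>r. r < \<kappa> \<Longrightarrow> \<gamma> r < (0::real)"
    and q_gram: "\<And>r t. r < \<kappa> \<Longrightarrow> t < \<kappa> \<Longrightarrow>
      (\<Sum>i<k. \<Sum>j<k. cnj (q r i) * X $$ (i, j) * q t j) = (if r = t then complex_of_real (\<gamma> r) else 0)"
    and D_sub: "D \<subseteq> analyticity_domain s" and g_nz: "\<And>z. z \<in> D \<Longrightarrow> g z \<noteq> 0"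
    and kernel: "\<And>z w. z \<in> D \<Longrightarrow> w \<in> D \<Longrightarrow> schur_kernel s z w =
      g z * cnj (g w) * ((\<Sum>i<k. \<Sum>j<k. R_fun i z * X $$ (i, j) * cnj (R_fun j w)) + carath_kernel F z w)"
    and radial: "\<forall>\<^sub>F r in at_left (1::real). of_real r \<in> D"
    and F: "((\<lambda>r. F (of_real r) / of_real (1 - r)) \<longlongrightarrow> 0) (at_left (1::real))"
    and z: "\<And>l. l < N \<Longrightarrow> z l \<in> D"
  shows "Re (\<Sum>l<N. \<Sum>j<N. cnj (c l) * carath_kernel F (z l) (z j) * c j) \<ge> 0"
proof (rule ccontr)
  define S where "S = (\<Sum>l<N. \<Sum>j<N. cnj (c l) * carath_kernel F (z l) (z j) * c j)"
  assume "\<not> Re (\<Sum>l<N. \<Sum>j<N. cnj (c l) * carath_kernel F (z l) (z j) * c j) \<ge> 0"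
  then have S_neg: "Re S < 0" by (simp add: S_def)
  have "cnj S = S"
    unfolding S_def cnj_sum
    by (subst sum.swap, intro sum.cong refl) (simp add: carath_kernel_def mult_ac add_ac)
  then have S_real: "S = of_real (Re S)" by (simp add: complex_eq_iff)
  \<comment> \<open>The last entry is the value \<open>S\<close> assumed to be negative; it is the
    negative square in excess of \<open>\<kappa>\<close>.\<close>
  define \<gamma>' where "\<gamma>' i = (if i < \<kappa> then \<gamma> i else Re S)" for i
  have "\<gamma>' i < 0" if "i < Suc \<kappa>" for i using that q_neg S_neg by (simp add: \<gamma>'_def)
  then obtain \<delta> :: real where \<delta>: "\<delta> > 0" "\<forall>i<Suc \<kappa>. \<gamma>' i + Suc \<kappa> * \<delta> < 0"
    by (rule small_perturbation_exists)
  have "inj_on (\<lambda>a. complex_of_nat (Suc a)) {..<k}" by (auto simp: inj_on_def)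
  then obtain V where V: "\<And>m n. m < k \<Longrightarrow> n < k \<Longrightarrow>
      (\<Sum>a<k. V m a * complex_of_nat (Suc a) ^ n) = (if m = n then 1 else 0)"
    by (rule vandermonde_left_inverse) blast
  define \<xi> where "\<xi> n = (\<Sum>l<N. cnj (R_fun n (z l)) * c l)" for n
  \<comment> \<open>The value prescribed for the part of the functional carried by the nodes. For
    \<open>i = \<kappa>\<close> it cancels \<open>\<xi>\<close>, the contribution of the given
    points.\<close>
  define qq where "qq i n = (if i < \<kappa> then q i n else - \<xi> n)" for i n
  define t where "t L a = L * real (Suc a)" for L :: real and a
  define \<zeta> where "\<zeta> L a = t L a / (1 + t L a)" for L a
  define w where "w L a = (if a < k then complex_of_real (\<zeta> L a) else z (a - k))" for L a
  \<comment> \<open>At a node \<open>1 / (1 + t L a)\<close> cancels the factor \<open>1 + t\<close>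
    of \<open>R_fun\<close>, and \<open>(1 / L) ^ n\<close> compensates the scale of
    \<open>t ^ n\<close>. The functional thus has its prescribed value for every
    \<open>L > 0\<close> although the node weights tend to 0.\<close>
  define e where "e L i a = (if a < k then (\<Sum>n<k. qq i n * of_real ((1 / L) ^ n) * V n a) * of_real (1 / (1 + t L a))
      else if i < \<kappa> then 0 else c (a - k))" for L i a
  let ?n = "k + N"
  \<comment> \<open>The division absorbs the factors \<open>g z * cnj (g w)\<close> of the
    kernel.\<close>
  define Y where "Y L i a = e L i a / cnj (g (w L a))" for L i a
  define A where "A L = kernel_mat s ?n (w L)" for L
  define G where "G L i j = (\<Sum>a<?n. \<Sum>b<?n. cnj (Y L i a) * A L $$ (a, b) * Y L j b)" for L i j
  define GF where "GF L i j = (\<Sum>a<?n. \<Sum>b<?n. cnj (e L i a) * carath_kernel F (w L a) (w L b) * e L j b)" for L i j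
  have \<zeta>_lim: "filterlim (\<lambda>L. \<zeta> L a) (at_left 1) at_top" for a
    unfolding \<zeta>_def t_def by (rule filterlim_radial_node) simp
  have w_D: "\<forall>\<^sub>F L in at_top. \<forall>a\<in>{..<?n}. w L a \<in> D"
  proof (intro eventually_ball_finite ballI)
    fix a assume a: "a \<in> {..<?n}"
    show "\<forall>\<^sub>F L in at_top. w L a \<in> D"
    proof (cases "a < k")
      case True
      then show ?thesis
        using radial \<zeta>_lim[of a] unfolding filterlim_iff w_def by auto
    next
      case False
      then show ?thesis using z[of "a - k"] a by (simp add: w_def)
    qed
  qed simp
  have \<xi>_e: "(\<Sum>a<?n. cnj (R_fun m (w L a)) * e L i a) = (if i < \<kappa> then q i m else 0)"
    if L: "L > 0" and m: "m < k" for L i m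
  proof -
    have "(\<Sum>a<k. cnj (R_fun m (w L a)) * e L i a) =
        (\<Sum>a<k. \<Sum>n<k. of_real (t L a ^ m) * (qq i n * of_real ((1 / L) ^ n) * V n a))"
    proof (intro sum.cong refl)
      fix a assume a: "a \<in> {..<k}"
      have tp: "t L a > 0" using L by (simp add: t_def)
      define Q where "Q = (\<Sum>n<k. qq i n * of_real ((1 / L) ^ n) * V n a)"
      have R: "cnj (R_fun m (w L a)) = of_real ((1 + t L a) * t L a ^ m)"
        using a R_fun_node[OF tp, of m] by (simp add: w_def \<zeta>_def)
      have "e L i a = Q * of_real (1 / (1 + t L a))"
        using a by (simp add: e_def Q_def)
      then have "cnj (R_fun m (w L a)) * e L i a =
          of_real ((1 + t L a) * t L a ^ m * (1 / (1 + t L a))) * Q"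
        unfolding R of_real_mult by (simp only: mult_ac)
      also have "(1 + t L a) * t L a ^ m * (1 / (1 + t L a)) = t L a ^ m"
        using tp by simp
      finally show "cnj (R_fun m (w L a)) * e L i a =
          (\<Sum>n<k. of_real (t L a ^ m) * (qq i n * of_real ((1 / L) ^ n) * V n a))"
        by (simp only: Q_def sum_distrib_left)
    qed
    also have "\<dots> = (\<Sum>n<k. qq i n * of_real ((1 / L) ^ n) * of_real (L ^ m) *
        (\<Sum>a<k. V n a * complex_of_nat (Suc a) ^ m))"
      by (subst sum.swap) (simp add: t_def power_mult_distrib sum_distrib_left mult_ac)
    also have "\<dots> = (\<Sum>n<k. if n = m then qq i m * of_real ((1 / L) ^ m * L ^ m) else 0)"
      using m by (intro sum.cong refl) (simp add: V del: of_nat_Suc)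
    also have "\<dots> = qq i m" using m L by (simp add: power_divide)
    finally show ?thesis
      by (simp add: sum_lessThan_add qq_def \<xi>_def w_def e_def)
  qed
  \<comment> \<open>Exact for each such \<open>L\<close>, not only in the limit: the
    \<open>X\<close> part depends on \<open>e\<close> only through the functional evaluated in
    \<open>\<xi>_e\<close>.\<close>
  have G_eq: "G L i j = (if i = j \<and> i < \<kappa> then of_real (\<gamma> i) else 0) + GF L i j"
    if L: "L > 0" and wD: "\<forall>a\<in>{..<?n}. w L a \<in> D" and ij: "i < Suc \<kappa>" "j < Suc \<kappa>" for L i j
  proof -
    have "G L i j = (\<Sum>a<?n. \<Sum>b<?n. cnj (e L i a) *
        ((\<Sum>m<k. \<Sum>n<k. R_fun m (w L a) * X $$ (m, n) * cnj (R_fun n (w L b))) + carath_kernel F (w L a) (w L b)) * e L j b)"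
      unfolding G_def
    proof (intro sum.cong refl)
      fix a b assume "a \<in> {..<?n}" "b \<in> {..<?n}"
      then show "cnj (Y L i a) * A L $$ (a, b) * Y L j b = cnj (e L i a) *
        ((\<Sum>m<k. \<Sum>n<k. R_fun m (w L a) * X $$ (m, n) * cnj (R_fun n (w L b))) + carath_kernel F (w L a) (w L b)) * e L j b"
        using wD g_nz[of "w L a"] g_nz[of "w L b"] kernel[of "w L a" "w L b"]
        by (simp add: Y_def A_def kernel_mat_def)
    qed
    also have "\<dots> = (\<Sum>a<?n. \<Sum>b<?n. \<Sum>m<k. \<Sum>n<k.
        (cnj (e L i a) * R_fun m (w L a)) * X $$ (m, n) * (cnj (R_fun n (w L b)) * e L j b)) + GF L i j"
      by (simp add: GF_def distrib_left distrib_right sum.distrib sum_distrib_left sum_distrib_right mult_ac)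
    also have "(\<Sum>a<?n. \<Sum>b<?n. \<Sum>m<k. \<Sum>n<k.
        (cnj (e L i a) * R_fun m (w L a)) * X $$ (m, n) * (cnj (R_fun n (w L b)) * e L j b)) =
      (\<Sum>m<k. \<Sum>n<k. \<Sum>a<?n. \<Sum>b<?n.
        (cnj (e L i a) * R_fun m (w L a)) * X $$ (m, n) * (cnj (R_fun n (w L b)) * e L j b))"
      by (rule sum_swap4)
    also have "\<dots> = (\<Sum>m<k. \<Sum>n<k. cnj (\<Sum>a<?n. cnj (R_fun m (w L a)) * e L i a) * X $$ (m, n) *
        (\<Sum>b<?n. cnj (R_fun n (w L b)) * e L j b))"
      by (simp add: sum_distrib_left sum_distrib_right mult_ac)
    also have "\<dots> = (\<Sum>m<k. \<Sum>n<k. cnj (if i < \<kappa> then q i m else 0) * X $$ (m, n) * (if j < \<kappa> then q j n else 0))"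
      using L by (intro sum.cong refl) (simp add: \<xi>_e)
    also have "\<dots> = (if i = j \<and> i < \<kappa> then of_real (\<gamma> i) else 0)"
      using ij q_gram[of i j] by (cases "i < \<kappa>"; cases "j < \<kappa>") auto
    finally show ?thesis .
  qed
  have e_lim: "((\<lambda>L. e L i a) \<longlongrightarrow> (if a < k then 0 else if i < \<kappa> then 0 else c (a - k))) at_top" for i a
  proof (cases "a < k")
    case True
    have 1: "((\<lambda>L. 1 / L) \<longlongrightarrow> (0::real)) at_top" by real_asymp
    have 2: "((\<lambda>L. 1 / (1 + t L a)) \<longlongrightarrow> 0) at_top" unfolding t_def by real_asymp
    have "((\<lambda>L. (\<Sum>n<k. qq i n * of_real ((1 / L) ^ n) * V n a) * of_real (1 / (1 + t L a))) \<longlongrightarrow>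
        (\<Sum>n<k. qq i n * of_real (0 ^ n) * V n a) * of_real 0) at_top"
      by (intro tendsto_mult tendsto_sum tendsto_const tendsto_of_real tendsto_power 1 2)
    then show ?thesis using True by (simp add: e_def)
  qed (simp add: e_def)
  \<comment> \<open>For a pair involving a node only the existence of the limit matters, because the
    node weights tend to 0. For two given points the kernel does not depend on
    \<open>L\<close>.\<close>
  have K_lim: "\<exists>l. ((\<lambda>L. carath_kernel F (w L a) (w L b)) \<longlongrightarrow> l) at_top" if "a < ?n" "b < ?n" for a b
  proof -
    have z1: "z (x - k) \<noteq> 1" if "x < ?n" "\<not> x < k" for x
    proof -
      have "z (x - k) \<in> analyticity_domain s" using z[of "x - k"] D_sub that by auto
      then show ?thesis by (auto simp: analyticity_domain_def)
    qed
    show ?thesis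
      using that carath_kernel_tendsto[OF F \<zeta>_lim[of a] \<zeta>_lim[of b]]
        carath_kernel_tendsto(2)[OF F \<zeta>_lim[of a] \<zeta>_lim[of b] z1[of a]]
        carath_kernel_tendsto(3)[OF F \<zeta>_lim[of b] \<zeta>_lim[of a] z1[of b]]
      unfolding w_def by (cases "a < k"; cases "b < k") auto
  qed
  then obtain Kl where Kl: "\<And>a b. a < ?n \<Longrightarrow> b < ?n \<Longrightarrow> ((\<lambda>L. carath_kernel F (w L a) (w L b)) \<longlongrightarrow> Kl a b) at_top"
    by metis
  have Kl_fixed: "Kl (k + l) (k + j) = carath_kernel F (z l) (z j)" if "l < N" "j < N" for l j
    using Kl[of "k + l" "k + j"] that tendsto_unique[OF trivial_limit_at_top_linorder _ tendsto_const]
    by (auto simp: w_def)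
  have GF_lim: "((\<lambda>L. GF L i j) \<longlongrightarrow> (if i = j \<and> i = \<kappa> then S else 0)) at_top"
    if ij: "i < Suc \<kappa>" "j < Suc \<kappa>" for i j
  proof -
    define el where "el i a = (if a < k then 0 else if i < \<kappa> then 0 else c (a - k))" for i a
    have "((\<lambda>L. GF L i j) \<longlongrightarrow> (\<Sum>a<?n. \<Sum>b<?n. cnj (el i a) * Kl a b * el j b)) at_top"
      unfolding GF_def
      by (intro tendsto_sum tendsto_mult tendsto_cnj Kl e_lim[folded el_def]) auto
    also have "(\<Sum>a<?n. \<Sum>b<?n. cnj (el i a) * Kl a b * el j b) = (if i = j \<and> i = \<kappa> then S else 0)"
      using ij by (auto simp: sum_lessThan_add el_def S_def Kl_fixed)
    finally show ?thesis .
  qed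
  have G_lim: "((\<lambda>L. G L i j) \<longlongrightarrow> (if i = j then of_real (\<gamma>' i) else 0)) at_top"
    if ij: "i < Suc \<kappa>" "j < Suc \<kappa>" for i j
  proof -
    have "((\<lambda>L. (if i = j \<and> i < \<kappa> then of_real (\<gamma> i) else 0) + GF L i j) \<longlongrightarrow>
        (if i = j \<and> i < \<kappa> then of_real (\<gamma> i) else 0) + (if i = j \<and> i = \<kappa> then S else 0)) at_top"
      by (intro tendsto_add tendsto_const GF_lim ij)
    also have "(if i = j \<and> i < \<kappa> then of_real (\<gamma> i) else 0) + (if i = j \<and> i = \<kappa> then S else 0) =
        (if i = j then of_real (\<gamma>' i) else 0)"
      using ij S_real by (auto simp: \<gamma>'_def)
    finally show ?thesis
    proof (rule Lim_transform_eventually)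
      show "\<forall>\<^sub>F L in at_top. (if i = j \<and> i < \<kappa> then of_real (\<gamma> i) else 0) + GF L i j = G L i j"
        using w_D eventually_gt_at_top[of 0] by eventually_elim (use G_eq ij in auto)
    qed
  qed
  have "\<forall>\<^sub>F L in at_top. \<forall>i\<in>{..<Suc \<kappa>}. \<forall>j\<in>{..<Suc \<kappa>}.
      cmod (G L i j - (if i = j then of_real (\<gamma>' i) else 0)) < \<delta>"
    by (intro eventually_ball_finite ballI) (use G_lim \<delta>(1) in \<open>auto simp: tendsto_iff dist_norm simp del: of_real_eq_iff\<close>)
  with w_D have "\<forall>\<^sub>F L in at_top. (\<forall>a\<in>{..<?n}. w L a \<in> D) \<and> (\<forall>i\<in>{..<Suc \<kappa>}. \<forall>j\<in>{..<Suc \<kappa>}.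
      cmod (G L i j - (if i = j then of_real (\<gamma>' i) else 0)) < \<delta>)"
    by (rule eventually_conj)
  then obtain L :: real where L: "\<forall>a\<in>{..<?n}. w L a \<in> D"
    "\<forall>i\<in>{..<Suc \<kappa>}. \<forall>j\<in>{..<Suc \<kappa>}. cmod (G L i j - (if i = j then of_real (\<gamma>' i) else 0)) < \<delta>"
    using eventually_happens'[OF trivial_limit_at_top_linorder] by blast
  have "Suc \<kappa> \<le> ev_neg (A L)"
  proof (rule ev_neg_ge_almost_diagonal[of _ ?n _ "Y L" \<gamma>' \<delta>])
    show "A L \<in> carrier_mat ?n ?n" by (simp add: A_def kernel_mat_def)
    show "hermitian_mat (A L)" by (simp add: A_def kernel_mat_hermitian)
  qed (use L(2) \<delta>(2) in \<open>auto simp: G_def less_imp_le\<close>)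
  moreover have "ev_neg (A L) \<le> \<kappa>"
  proof -
    have "w L ` {..<?n} \<subseteq> analyticity_domain s" using L(1) D_sub by auto
    then show ?thesis using s unfolding gen_schur_def A_def by blast
  qed
  ultimately show False by simp
qed

section \<open>Boundary rigidity\<close>

text \<open>A positive semidefinite 2 by 2 form with a zero diagonal entry has zero off-diagonal
  entries. In the limit the entry at (r, r) is 0 and the one at (z, r) is \<open>B\<close>.\<close>

lemma carath_kernel_psd_imp_zero:
  assumes psd: "\<And>(z :: nat \<Rightarrow> complex) c. (\<And>l. l < 2 \<Longrightarrow> z l \<in> D) \<Longrightarrow>
      Re (\<Sum>l<2::nat. \<Sum>j<2::nat. cnj (c l) * carath_kernel F (z l) (z j) * c j) \<ge> 0"
    and radial: "\<forall>\<^sub>F r in at_left (1::real). of_real r \<in> D"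
    and F: "((\<lambda>r. F (of_real r) / of_real (1 - r)) \<longlongrightarrow> 0) (at_left (1::real))"
    and z: "z \<in> D" "z \<noteq> 1"
  shows "F z = 0"
proof (rule ccontr)
  assume "F z \<noteq> 0"
  define B where "B = F z / (1 - z)"
  have B: "B \<noteq> 0" using \<open>F z \<noteq> 0\<close> z(2) by (simp add: B_def)
  define A where "A = carath_kernel F z z"
  \<comment> \<open>Chosen so that the weights 1 at \<open>z\<close> and
    \<open>c = - of_real M * cnj B\<close> at the radial point give the limit
    \<open>Re A - 2 * (\<bar>Re A\<bar> + 1)\<close>, which is negative.\<close>
  define M where "M = (\<bar>Re A\<bar> + 1) / (cmod B)\<^sup>2"
  define v where "v L = L * 1 / (1 + L * 1)" for L :: real
  have v: "filterlim v (at_left 1) at_top"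
    unfolding v_def by (rule filterlim_radial_node) simp
  define c where "c = - of_real M * cnj B"
  have "((\<lambda>L. A + carath_kernel F z (of_real (v L)) * c + (cnj c * carath_kernel F (of_real (v L)) z +
      cnj c * carath_kernel F (of_real (v L)) (of_real (v L)) * c)) \<longlongrightarrow>
      A + B * c + (cnj c * (cnj (F z) / (1 - cnj z)) + cnj c * 0 * c)) at_top"
    unfolding B_def
    by (intro tendsto_intros carath_kernel_tendsto(1)[OF F v v] carath_kernel_tendsto(2,3)[OF F v v z(2)])
  then have lim: "((\<lambda>L. Re (A + carath_kernel F z (of_real (v L)) * c + (cnj c * carath_kernel F (of_real (v L)) z +
      cnj c * carath_kernel F (of_real (v L)) (of_real (v L)) * c))) \<longlongrightarrow>
      Re (A + B * c + (cnj c * (cnj (F z) / (1 - cnj z)) + cnj c * 0 * c))) at_top"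
    by (rule tendsto_Re)
  have "\<forall>\<^sub>F L in at_top. of_real (v L) \<in> D"
    using radial v by (auto simp: filterlim_iff)
  then have "\<forall>\<^sub>F L in at_top. 0 \<le> Re (A + carath_kernel F z (of_real (v L)) * c + (cnj c * carath_kernel F (of_real (v L)) z +
      cnj c * carath_kernel F (of_real (v L)) (of_real (v L)) * c))"
  proof eventually_elim
    case (elim L)
    have "0 \<le> Re (\<Sum>l<2::nat. \<Sum>j<2::nat. cnj ((if l = 0 then 1 else c)) *
        carath_kernel F (if l = 0 then z else of_real (v L)) (if j = 0 then z else of_real (v L)) * (if j = 0 then 1 else c))"
      by (rule psd[of "\<lambda>l. if l = 0 then z else of_real (v L)" "\<lambda>l. if l = 0 then 1 else c"])
        (use elim z(1) in auto)
    then show ?case by (simp add: numeral_2_eq_2 A_def)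
  qed
  from tendsto_lowerbound[OF lim this]
  have "0 \<le> Re (A + B * c + cnj (B * c))" by (simp add: B_def mult.commute)
  also have "B * c = of_real (- (M * (cmod B)\<^sup>2))"
  proof -
    have "B * c = - of_real M * (cnj B * B)" by (simp add: c_def)
    then show ?thesis by (simp only: cnj_mult_self) simp
  qed
  also have "M * (cmod B)\<^sup>2 = \<bar>Re A\<bar> + 1"
    using B by (simp add: M_def)
  finally have "0 \<le> Re A - 2 * (\<bar>Re A\<bar> + 1)" by simp
  then show False using abs_ge_self[of "Re A"] abs_ge_zero[of "Re A"] by argo
qed

text \<open>The rank one matrix \<open>u u\<^sup>* J\<close> has rows \<open>(1, - \<tau> 0)\<close>
  and \<open>(cnj (\<tau> 0), - 1)\<close>. Where the denominator is nonzero, one minus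
  \<open>cnj (\<tau> 0)\<close> times the value is \<open>e / (1 + \<phi> * e)\<close> with
  \<open>e = 1 - cnj (\<tau> 0) * x\<close>, which is the translation by \<open>\<phi>\<close> of
  \<open>1 / e\<close>.\<close>

lemma linear_fractional_Theta:
  fixes \<tau> :: "nat \<Rightarrow> complex" and k :: nat and z0 z x :: complex
  assumes "norm (\<tau> 0) = 1"
  defines "\<phi> \<equiv> theta_phi k \<tau> z0 z"
  shows "linear_fractional (Theta k \<tau> z0 z) x =
    ((1 - \<phi>) * x + \<phi> * \<tau> 0) / (1 + \<phi> * (1 - cnj (\<tau> 0) * x))"
proof -
  have u: "col_u t = mat 2 1 (\<lambda>(i, j). if i = 0 then 1 else cnj t)" for t
    by (rule eq_matI) (auto simp: col_u_def mat_of_rows_list_def less_2_cases_iff)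
  have J: "mat_J = mat 2 2 (\<lambda>(i, j). if i = j then (if i = 0 then 1 else - 1) else 0)"
    by (rule eq_matI) (auto simp: mat_J_def mat_of_rows_list_def less_2_cases_iff)
  have uc: "col_u t \<in> carrier_mat 2 1" "mat_adjoint (col_u t) \<in> carrier_mat 1 2" for t
    by (simp_all add: u)
  have Jc: "mat_J \<in> carrier_mat 2 2" by (simp add: J)
  note uu = mult_carrier_mat[OF uc]
  have t: "\<tau> 0 * cnj (\<tau> 0) = 1" using assms(1) by (simp add: complex_norm_square[symmetric])
  have uu_ix: "(col_u (\<tau> 0) * mat_adjoint (col_u (\<tau> 0))) $$ (i, j) =
      (if i = 0 then 1 else cnj (\<tau> 0)) * (if j = 0 then 1 else \<tau> 0)" if "i < 2" "j < 2" for i j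
    using that by (subst mat_mult_index[OF uc that]) (auto simp: u)
  have uuJ: "(col_u (\<tau> 0) * mat_adjoint (col_u (\<tau> 0)) * mat_J) $$ (i, j) =
      (if i = 0 then 1 else cnj (\<tau> 0)) * (if j = 0 then 1 else - \<tau> 0)" if "i < 2" "j < 2" for i j
    unfolding mat_mult_index[OF uu Jc that] using that
    by (auto simp: uu_ix J numeral_2_eq_2 less_Suc_eq simp del: index_mult_mat(1))
  have "dim_row (col_u (\<tau> 0) * mat_adjoint (col_u (\<tau> 0)) * mat_J) = 2"
    "dim_col (col_u (\<tau> 0) * mat_adjoint (col_u (\<tau> 0)) * mat_J) = 2"
    using mult_carrier_mat[OF uu Jc] by blast+
  then have \<Theta>: "Theta k \<tau> z0 z $$ (i, j) = (if i = j then 1 else 0) -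
      \<phi> * ((if i = 0 then 1 else cnj (\<tau> 0)) * (if j = 0 then 1 else - \<tau> 0))" if "i < 2" "j < 2" for i j
    using that unfolding Theta_def \<phi>_def theta_phi_def[symmetric]
    by (simp add: uuJ del: index_mult_mat)
  have "Theta k \<tau> z0 z $$ (0, 0) = 1 - \<phi>" "Theta k \<tau> z0 z $$ (0, 1) = \<phi> * \<tau> 0"
    "Theta k \<tau> z0 z $$ (1, 0) = - \<phi> * cnj (\<tau> 0)" "Theta k \<tau> z0 z $$ (1, 1) = 1 + \<phi>"
    using t by (simp_all add: \<Theta> mult.commute[of "cnj _"])
  then show ?thesis
    unfolding linear_fractional_def by (simp only:) (simp add: algebra_simps)
qed

section \<open>From nontangential to radial asymptotics\<close>

lemma stolz_radial: "filterlim complex_of_real (at 1 within stolz 2) (at_left 1)"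
proof -
  have "((\<lambda>r. complex_of_real r) \<longlongrightarrow> of_real 1) (at_left (1::real))"
    by (intro tendsto_intros)
  moreover have "\<forall>\<^sub>F r in at_left (1::real). complex_of_real r \<in> stolz 2 - {1}"
    using eventually_at_left_real[of 0 1, simplified]
  proof eventually_elim
    case (elim r)
    \<comment> \<open>On the radius |r - 1| = 1 - r < 2 (1 - r), so it lies in the region of
      aperture 2.\<close>
    have "cmod (complex_of_real r - 1) = 1 - r"
      using elim norm_of_real[of "r - 1", where ?'a = complex] by simp
    then show ?case using elim by (auto simp: stolz_def)
  qed
  ultimately show ?thesis by (simp add: filterlim_at)
qed

lemma nontangential_bigo_radial:
  assumes "nontangential_bigo f m" "n < m"
  shows "((\<lambda>r. f (of_real r) / of_real ((1 - r) ^ n)) \<longlongrightarrow> 0) (at_left (1::real))"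
proof -
  have "f \<in> O[at 1 within stolz 2](\<lambda>z. (z - 1) ^ m)"
    using assms(1) by (simp add: nontangential_bigo_def)
  then have "(\<lambda>r. f (of_real r)) \<in> O[at_left 1](\<lambda>r. (complex_of_real r - 1) ^ m)"
    by (rule landau_o.big.compose[OF _ stolz_radial])
  then obtain C where C: "C > 0" "\<forall>\<^sub>F r in at_left 1. cmod (f (of_real r)) \<le> C * cmod ((complex_of_real r - 1) ^ m)"
    by (rule landau_o.bigE)
  have "\<forall>\<^sub>F r in at_left (1::real). 0 < r \<and> r < 1"
    using eventually_at_left_real[of 0 1] by (auto elim: eventually_mono)
  with C(2) have "\<forall>\<^sub>F r in at_left (1::real). cmod (f (of_real r) / of_real ((1 - r) ^ n)) \<le> C * (1 - r) ^ (m - n)"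
  proof eventually_elim
    case (elim r)
    have "cmod (complex_of_real r - 1) = 1 - r"
      using elim norm_of_real[of "r - 1", where ?'a = complex] by simp
    then have "cmod (f (of_real r)) \<le> C * (1 - r) ^ (m - n) * (1 - r) ^ n"
      using elim assms(2) by (simp add: norm_power mult.assoc power_add[symmetric])
    then show ?case using elim by (simp add: norm_divide norm_power pos_divide_le_eq del: of_real_power of_real_diff)
  qed
  moreover have "((\<lambda>r. C * (1 - r) ^ (m - n)) \<longlongrightarrow> 0) (at_left (1::real))"
  proof -
    have "((\<lambda>r. C * (1 - r) ^ (m - n)) \<longlongrightarrow> C * (1 - 1) ^ (m - n)) (at_left (1::real))"
      by (intro tendsto_intros)
    moreover have "(0::real) ^ (m - n) = 0" using assms(2) by (intro zero_power) simp
    ultimately show ?thesis by simp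
  qed
  ultimately show ?thesis by (rule Lim_null_comparison)
qed

theorem theorem3p1:
  fixes k :: nat and \<tau> :: "nat \<Rightarrow> complex" and z0 x :: complex
    and s b :: "complex \<Rightarrow> complex"
  assumes "k \<ge> 1"
    and "norm (\<tau> 0) = 1"
    and "\<tau> k \<noteq> 0"
    and "hermitian_mat (pick_P k \<tau>)"
    and "norm z0 = 1" and "z0 \<noteq> 1"
    and "norm x = 1" and "x \<noteq> \<tau> 0"
    and "b = (\<lambda>z. linear_fractional (Theta k \<tau> z0 z) x)"
    and "s \<in> gen_schur (ev_neg (pick_P k \<tau>))"
    and "nontangential_bigo (\<lambda>z. s z - (\<tau> 0 + (\<Sum>i=k..2*k-1. \<tau> i * (z - 1) ^ i))) (2 * k)"
    and "nontangential_bigo (\<lambda>z. s z - b z) (2 * k + 2)"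
  shows "\<forall>z\<in>ball 0 1. s z = b z"
proof -

  \<comment> \<open>The coordinate 1 / g and the kernel identity\<close>
  define t where "t = \<tau> 0"
  have tt: "t * cnj t = 1" "cnj t * t = 1"
    using assms(2) by (simp_all add: t_def complex_norm_square[symmetric] mult.commute[of "cnj _"])
  have tmul: "t * (cnj t * u) = u" "cnj t * (t * u) = u" for u
    using tt by (simp_all add: mult.assoc[symmetric])
  have t0: "t \<noteq> 0" using tt by auto
  define e where "e = 1 - cnj t * x"
  have e0: "e \<noteq> 0"
  proof
    assume "e = 0"
    then have "cnj t * x = 1" by (simp add: e_def)
    then have "x = t" using tmul(1)[of x] by simp
    then show False using assms(8) by (simp add: t_def)
  qed
  have xx: "x * cnj x = 1" using assms(7) by (simp add: complex_norm_square[symmetric])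
  \<comment> \<open>This is |1 - e| = 1 expanded; divided by \<open>e * cnj e\<close> it says that
    \<open>1 / e\<close> has real part 1/2.\<close>
  have "e + cnj e = e * cnj e"
  proof -
    have "(cnj t * x) * cnj (cnj t * x) = (t * cnj t) * (x * cnj x)" by (simp add: mult_ac)
    then show ?thesis using tt xx by (simp add: e_def algebra_simps)
  qed
  then have re_e: "1 / e + 1 / cnj e = 1"
    using e0 by (simp add: add_divide_eq_iff divide_add_eq_iff field_simps)
  obtain X where X: "X \<in> carrier_mat k k" "hermitian_mat X"
    "pick_P k \<tau> * X = 1\<^sub>m k" "X * pick_P k \<tau> = 1\<^sub>m k"
    and phi_kernel: "\<forall>z w. z \<noteq> 1 \<longrightarrow> w \<noteq> 1 \<longrightarrow> theta_phi k \<tau> z0 z + cnj (theta_phi k \<tau> z0 w) =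
      (1 - z * cnj w) * (\<Sum>i<k. \<Sum>j<k. R_fun i z * X $$ (i, j) * cnj (R_fun j w))"
    by (rule theta_phi_kernel[OF t0[unfolded t_def] assms(3-6)])
  define \<phi> where "\<phi> = theta_phi k \<tau> z0"
  \<comment> \<open>Stands for \<open>1 / (1 - cnj t * b z)\<close> but stays finite and continuous
    in the disk: poles of \<open>b\<close> become zeros of \<open>fb\<close>.\<close>
  define fb where "fb z = \<phi> z + 1 / e" for z
  define g where "g z = 1 - cnj t * s z" for z
  define F where "F z = 1 / g z - fb z" for z
  \<comment> \<open>Leaves out the poles of \<open>s\<close> and the points with
    \<open>s z = t\<close>, where \<open>1 / g\<close> is singular.\<close>
  define D where "D = {z \<in> analyticity_domain s. g z \<noteq> 0}"
  have s_g: "s z = t * (1 - g z)" for z by (simp add: g_def tmul)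
  have D_ball: "z \<in> ball 0 1" if "z \<in> D" for z
    using that by (simp add: D_def analyticity_domain_def)
  have zw1: "z * cnj w \<noteq> 1" if "z \<in> ball 0 1" "w \<in> ball 0 1" for z w :: complex
  proof -
    have "cmod (z * cnj w) < 1"
      using that mult_strict_mono'[of "cmod z" 1 "cmod w" 1] by (simp add: norm_mult)
    then show ?thesis by auto
  qed
  have ball1: "z \<noteq> 1" if "z \<in> ball 0 1" for z :: complex using that by auto
  have b_eq: "b z = ((1 - \<phi> z) * x + \<phi> z * t) / (e * fb z)" for z
    using e0 by (simp add: assms(9) linear_fractional_Theta[of \<tau>, OF assms(2)] fb_def \<phi>_def e_def t_def distrib_left mult.commute add.commute)
  have b_fb: "1 - cnj t * b z = 1 / fb z" if "fb z \<noteq> 0" for z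
  proof -
    have "e * fb z - cnj t * ((1 - \<phi> z) * x + \<phi> z * t) = e"
      using e0 tt by (simp add: fb_def distrib_left) (simp add: e_def algebra_simps tt)
    moreover have "e * fb z * (1 - cnj t * b z) = e * fb z - cnj t * ((1 - \<phi> z) * x + \<phi> z * t)"
      using that e0 by (simp add: b_eq right_diff_distrib)
    ultimately have "e * (fb z * (1 - cnj t * b z)) = e * 1" by (simp only: mult.assoc mult_1_right)
    then have "fb z * (1 - cnj t * b z) = 1" using e0 mult_left_cancel by blast
    then show ?thesis using that by (simp add: nonzero_eq_divide_eq mult.commute)
  qed
  \<comment> \<open>Division by zero gives the value 0, the same that the normal form assigns to
    \<open>s\<close> at a pole.\<close>
  have b_pole: "b z = 0" if "fb z = 0" for z using that by (simp add: b_eq)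
  have kernel: "schur_kernel s z w = g z * cnj (g w) *
      ((\<Sum>i<k. \<Sum>j<k. R_fun i z * X $$ (i, j) * cnj (R_fun j w)) + carath_kernel F z w)"
    if "z \<in> D" "w \<in> D" for z w
  proof -
    define \<rho> where "\<rho> = (\<Sum>i<k. \<Sum>j<k. R_fun i z * X $$ (i, j) * cnj (R_fun j w))"
    have gz: "g z \<noteq> 0" "g w \<noteq> 0" using that by (auto simp: D_def)
    have d: "1 - z * cnj w \<noteq> 0" using zw1[OF D_ball D_ball, OF that] by simp
    have "fb z + cnj (fb w) = (1 - z * cnj w) * \<rho> + 1"
      using phi_kernel that[THEN D_ball, THEN ball1] re_e
      by (simp add: fb_def \<phi>_def \<rho>_def algebra_simps)
    then have "carath_kernel F z w = ((1 / g z + 1 / cnj (g w) - 1) - (1 - z * cnj w) * \<rho>) / (1 - z * cnj w)"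
      by (simp add: carath_kernel_def F_def algebra_simps)
    then have "\<rho> + carath_kernel F z w = (1 / g z + 1 / cnj (g w) - 1) / (1 - z * cnj w)"
      using d by (simp add: diff_divide_distrib)
    moreover have "g z * cnj (g w) * (1 / g z + 1 / cnj (g w) - 1) = 1 - s z * cnj (s w)"
      using gz tt by (simp add: s_g field_simps tmul)
    ultimately show ?thesis
      unfolding \<rho>_def[symmetric] by (simp add: schur_kernel_def)
  qed
  have mero: "s nicely_meromorphic_on ball 0 1" using assms(10) by (simp add: gen_schur_def)

  \<comment> \<open>Radial asymptotics at 1\<close>
  define G0 where "G0 = - cnj t * ((- 1) ^ k * \<tau> k)"
  have G0: "G0 \<noteq> 0" using t0 assms(3) by (simp add: G0_def)
  have ev01: "\<forall>\<^sub>F r in at_left (1::real). 0 < r \<and> r < 1"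
    using eventually_at_left_real[of 0 1] by (auto elim: eventually_mono)
  have pw_lim: "((\<lambda>r. complex_of_real ((1 - r) ^ n)) \<longlongrightarrow> 0 ^ n) (at_left (1::real))" for n
  proof -
    have "((\<lambda>r. complex_of_real ((1 - r) ^ n)) \<longlongrightarrow> of_real ((1 - 1) ^ n)) (at_left (1::real))"
      by (intro tendsto_intros)
    then show ?thesis by simp
  qed
  \<comment> \<open>The sign in \<open>G0\<close> comes from (r - 1)^k = (-1)^k (1 - r)^k. The
    remainder of order 2k is negligible against order k because \<open>k \<ge> 1\<close>.\<close>
  have g_lim: "((\<lambda>r. g (of_real r) / of_real ((1 - r) ^ k)) \<longlongrightarrow> G0) (at_left (1::real))"
  proof -
    have 1: "((\<lambda>r. (s (of_real r) - (\<tau> 0 + (\<Sum>i=k..2*k-1. \<tau> i * (of_real r - 1) ^ i))) / of_real ((1 - r) ^ k)) \<longlongrightarrow> 0) (at_left (1::real))"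
      using nontangential_bigo_radial[OF assms(11), of k] assms(1) by simp
    have "((\<lambda>r. \<Sum>i=k..2*k-1. \<tau> i * (- 1) ^ i * complex_of_real ((1 - r) ^ (i - k))) \<longlongrightarrow>
        (\<Sum>i=k..2*k-1. \<tau> i * (- 1) ^ i * 0 ^ (i - k))) (at_left (1::real))"
      by (intro tendsto_sum tendsto_mult tendsto_const pw_lim)
    also have "(\<Sum>i=k..2*k-1. \<tau> i * (- 1) ^ i * (0::complex) ^ (i - k)) = (\<Sum>i=k..2*k-1. if i = k then \<tau> k * (- 1) ^ k else 0)"
      by (intro sum.cong refl) auto
    also have "\<dots> = \<tau> k * (- 1) ^ k" using assms(1) by simp
    finally have 2: "((\<lambda>r. \<Sum>i=k..2*k-1. \<tau> i * (- 1) ^ i * complex_of_real ((1 - r) ^ (i - k))) \<longlongrightarrow> \<tau> k * (- 1) ^ k) (at_left (1::real))" .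
    from tendsto_mult[OF tendsto_const[of "- cnj t"] tendsto_add[OF 1 2]]
    have "((\<lambda>r. - cnj t * ((s (of_real r) - (\<tau> 0 + (\<Sum>i=k..2*k-1. \<tau> i * (of_real r - 1) ^ i))) / of_real ((1 - r) ^ k) +
        (\<Sum>i=k..2*k-1. \<tau> i * (- 1) ^ i * complex_of_real ((1 - r) ^ (i - k))))) \<longlongrightarrow> G0) (at_left (1::real))"
      by (simp add: G0_def mult_ac)
    then show ?thesis
    proof (rule Lim_transform_eventually)
      show "\<forall>\<^sub>F r in at_left 1. - cnj t * ((s (of_real r) - (\<tau> 0 + (\<Sum>i=k..2*k-1. \<tau> i * (of_real r - 1) ^ i))) / of_real ((1 - r) ^ k) +
        (\<Sum>i=k..2*k-1. \<tau> i * (- 1) ^ i * complex_of_real ((1 - r) ^ (i - k)))) = g (of_real r) / of_real ((1 - r) ^ k)"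
        using ev01
      proof eventually_elim
        case (elim r)
        define h where "h = complex_of_real (1 - r)"
        have h: "h \<noteq> 0" "complex_of_real r - 1 = - 1 * h" using elim by (auto simp: h_def)
        have "(\<Sum>i=k..2*k-1. \<tau> i * (of_real r - 1) ^ i) = (\<Sum>i=k..2*k-1. \<tau> i * (- 1) ^ i * h ^ (i - k)) * h ^ k"
          unfolding sum_distrib_right h(2)
          by (intro sum.cong refl) (simp add: power_minus[of h] power_add[symmetric] mult.assoc)
        then have eq: "(s (of_real r) - (\<tau> 0 + (\<Sum>i=k..2*k-1. \<tau> i * (of_real r - 1) ^ i))) / h ^ k +
            (\<Sum>i=k..2*k-1. \<tau> i * (- 1) ^ i * h ^ (i - k)) = (s (of_real r) - t) / h ^ k"
          using h(1) by (simp add: t_def diff_divide_distrib add_divide_distrib)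
        have gt: "- cnj t * (s (of_real r) - t) = g (of_real r)"
          using tt by (simp add: g_def algebra_simps)
        show ?case
          by (simp only: of_real_power h_def[symmetric] eq times_divide_eq_right gt)
      qed
    qed
  qed
  have sb_lim: "((\<lambda>r. (s (of_real r) - b (of_real r)) / of_real ((1 - r) ^ n)) \<longlongrightarrow> 0) (at_left (1::real))"
    if "n < 2 * k + 2" for n
    by (rule nontangential_bigo_radial[OF assms(12) that])
  define gb where "gb z = 1 - cnj t * b z" for z
  \<comment> \<open>\<open>s\<close> and \<open>b\<close> agree beyond order k, so \<open>gb\<close>
    has the same leading coefficient as \<open>g\<close>.\<close>
  have gb_lim: "((\<lambda>r. gb (of_real r) / of_real ((1 - r) ^ k)) \<longlongrightarrow> G0) (at_left (1::real))"
  proof -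
    have "((\<lambda>r. g (of_real r) / of_real ((1 - r) ^ k) + cnj t * ((s (of_real r) - b (of_real r)) / of_real ((1 - r) ^ k))) \<longlongrightarrow>
        G0 + cnj t * 0) (at_left (1::real))"
      by (intro tendsto_add tendsto_mult tendsto_const g_lim sb_lim) simp
    moreover have "g z / c + cnj t * ((s z - b z) / c) = gb z / c" for z c
      by (simp add: g_def gb_def add_divide_distrib[symmetric] algebra_simps)
    ultimately show ?thesis by simp
  qed
  have vanish: "((\<lambda>r. f (of_real r)) \<longlongrightarrow> 0) (at_left (1::real))"
    if "((\<lambda>r. f (of_real r) / of_real ((1 - r) ^ k)) \<longlongrightarrow> G0) (at_left (1::real))" for f :: "complex \<Rightarrow> complex"
  proof -
    have "((\<lambda>r. f (of_real r) / of_real ((1 - r) ^ k) * of_real ((1 - r) ^ k)) \<longlongrightarrow> G0 * 0 ^ k) (at_left (1::real))"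
      by (intro tendsto_mult that pw_lim)
    moreover have "\<forall>\<^sub>F r in at_left (1::real). f (of_real r) / of_real ((1 - r) ^ k) * of_real ((1 - r) ^ k) = f (of_real r)"
      using ev01 by eventually_elim auto
    ultimately have "((\<lambda>r. f (of_real r)) \<longlongrightarrow> G0 * 0 ^ k) (at_left (1::real))"
      by (rule Lim_transform_eventually)
    moreover have "G0 * 0 ^ k = 0" using assms(1) by (simp add: zero_power)
    ultimately show ?thesis by simp
  qed
  have nz: "\<forall>\<^sub>F r in at_left (1::real). f (of_real r) \<noteq> 0"
    if "((\<lambda>r. f (of_real r) / of_real ((1 - r) ^ k)) \<longlongrightarrow> G0) (at_left (1::real))" for f :: "complex \<Rightarrow> complex"
    using tendsto_imp_eventually_ne[OF that G0] by eventually_elim auto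
  \<comment> \<open>At a zero of \<open>fb\<close> the default value of \<open>b\<close> would make
    \<open>gb\<close> equal to 1, which is excluded once \<open>gb\<close> is close to 0.\<close>
  have "\<forall>\<^sub>F r in at_left (1::real). gb (of_real r) \<noteq> 1"
    using tendsto_imp_eventually_ne[OF vanish[OF gb_lim], of 1] by simp
  then have fb_nz: "\<forall>\<^sub>F r in at_left (1::real). fb (of_real r) \<noteq> 0"
    by eventually_elim (auto simp: gb_def b_pole)
  \<comment> \<open>Here \<open>g \<noteq> 1\<close> means \<open>s \<noteq> 0\<close>; in normal
    form \<open>s\<close> is 0 at its poles, so such a point is not a pole.\<close>
  have "\<forall>\<^sub>F r in at_left (1::real). g (of_real r) \<noteq> 1"
    using tendsto_imp_eventually_ne[OF vanish[OF g_lim], of 1] by simp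
  then have radial: "\<forall>\<^sub>F r in at_left (1::real). of_real r \<in> D"
    using nz[OF g_lim] ev01
  proof eventually_elim
    case (elim r)
    have r: "complex_of_real r \<in> ball 0 1" using elim by simp
    have "s (of_real r) \<noteq> 0" using elim(1) by (auto simp: g_def)
    then have "s \<midarrow>of_real r\<rightarrow> s (of_real r)"
      using mero r unfolding nicely_meromorphic_on_def by blast
    then have "\<not> is_pole s (of_real r)"
      unfolding is_pole_def by (metis at_neq_bot not_tendsto_and_filterlim_at_infinity)
    then have "s analytic_on {of_real r}"
      by (rule nicely_meromorphic_on_imp_analytic_at[OF mero r])
    then show ?case using elim(2) r by (simp add: D_def analyticity_domain_def)
  qed
  \<comment> \<open>The exponent 2k + 1 is k for \<open>g\<close>, k for \<open>gb\<close> and one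
    for the quotient by \<open>1 - r\<close>; it lies below the available order 2k + 2.\<close>
  have F_lim: "((\<lambda>r. F (of_real r) / of_real (1 - r)) \<longlongrightarrow> 0) (at_left (1::real))"
  proof -
    have "((\<lambda>r. cnj t * ((s (of_real r) - b (of_real r)) / of_real ((1 - r) ^ (2 * k + 1))) /
        ((g (of_real r) / of_real ((1 - r) ^ k)) * (gb (of_real r) / of_real ((1 - r) ^ k)))) \<longlongrightarrow> cnj t * 0 / (G0 * G0)) (at_left (1::real))"
      by (intro tendsto_divide tendsto_mult tendsto_const g_lim gb_lim sb_lim) (use G0 in auto)
    then have "((\<lambda>r. cnj t * ((s (of_real r) - b (of_real r)) / of_real ((1 - r) ^ (2 * k + 1))) /
        ((g (of_real r) / of_real ((1 - r) ^ k)) * (gb (of_real r) / of_real ((1 - r) ^ k)))) \<longlongrightarrow> 0) (at_left (1::real))"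
      by simp
    then show ?thesis
    proof (rule Lim_transform_eventually)
      show "\<forall>\<^sub>F r in at_left 1. cnj t * ((s (of_real r) - b (of_real r)) / of_real ((1 - r) ^ (2 * k + 1))) /
        ((g (of_real r) / of_real ((1 - r) ^ k)) * (gb (of_real r) / of_real ((1 - r) ^ k))) = F (of_real r) / of_real (1 - r)"
        using ev01 fb_nz nz[OF g_lim] nz[OF gb_lim]
      proof eventually_elim
        case (elim r)
        define h where "h = complex_of_real (1 - r)"
        have h: "h \<noteq> 0" using elim by (auto simp: h_def)
        have fbr: "fb (of_real r) = 1 / gb (of_real r)"
          using b_fb[OF elim(2)] by (simp add: gb_def)
        have num: "cnj t * (s (of_real r) - b (of_real r)) = gb (of_real r) - g (of_real r)"
          by (simp add: g_def gb_def algebra_simps)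
        have Fr: "F (of_real r) = cnj t * (s (of_real r) - b (of_real r)) / (g (of_real r) * gb (of_real r))"
          unfolding F_def fbr num using elim by (simp add: field_simps)
        have "h ^ (2 * k + 1) = h ^ k * h ^ k * h" by (simp add: mult_2 power_add)
        then show ?case
          unfolding of_real_power h_def[symmetric] Fr using h elim by (simp add: field_simps)
      qed
    qed
  qed
  obtain q \<gamma> where q: "\<forall>r<ev_neg (pick_P k \<tau>). \<gamma> r < (0::real)"
    "\<forall>r<ev_neg (pick_P k \<tau>). \<forall>r'<ev_neg (pick_P k \<tau>).
      (\<Sum>i<k. \<Sum>j<k. cnj (q r i) * X $$ (i, j) * q r' j) = (if r = r' then complex_of_real (\<gamma> r) else 0)"
    by (rule inverse_negative_vectors[OF pick_P_carrier assms(4) X(1,4)])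
  have psd: "Re (\<Sum>l<N. \<Sum>j<N. cnj (c l) * carath_kernel F (u l) (u j) * c j) \<ge> 0"
    if "\<And>l. l < N \<Longrightarrow> u l \<in> D" for N :: nat and u c :: "nat \<Rightarrow> complex"
    by (rule carath_kernel_psd[OF assms(10), where D = D and g = g and X = X and q = q and \<gamma> = \<gamma> and k = k])
      (use q kernel radial F_lim that in \<open>auto simp: D_def\<close>)
  have F0: "F z = 0" if "z \<in> D" for z
    by (rule carath_kernel_psd_imp_zero[of D, OF psd radial F_lim that ball1[OF D_ball[OF that]]])
  have g_fb: "g z * fb z = 1" if "z \<in> D" for z
    using F0[OF that] that by (simp add: F_def D_def field_simps)

  \<comment> \<open>From D to the whole disk\<close>
  have D_near: "\<forall>\<^sub>F w in at z. w \<in> D" if z: "z \<in> ball 0 1" for z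
  proof -
    obtain r :: real where r: "of_real r \<in> D"
      using eventually_happens'[OF trivial_limit_at_left_real radial] by blast
    then have "s (of_real r) \<noteq> t" using tt(2) by (auto simp: D_def g_def)
    \<comment> \<open>A radial point of \<open>D\<close> rules out that \<open>s\<close> is
      constantly \<open>t\<close>, so the solutions of \<open>s w = t\<close> are sparse.\<close>
    then have "\<forall>\<^sub>\<approx>w\<in>ball 0 1. s w \<noteq> t"
      using nicely_meromorphic_imp_constant_or_avoid[OF mero, of t] D_ball[OF r] by blast
    moreover have "\<forall>\<^sub>\<approx>w\<in>ball 0 1. s analytic_on {w}"
      using meromorphic_on_imp_analytic_cosparse mero by (simp add: nicely_meromorphic_on_def)
    ultimately have "\<forall>\<^sub>F w in at z. s w \<noteq> t" "\<forall>\<^sub>F w in at z. s analytic_on {w}"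
      using z by (auto simp: eventually_cosparse_open_eq)
    moreover have "\<forall>\<^sub>F w in at z. w \<in> ball 0 1"
      using z by (intro eventually_at_in_open') auto
    ultimately show ?thesis
    proof eventually_elim
      case (elim w)
      have "g w \<noteq> 0" using elim(1) s_g[of w] by auto
      then show ?case using elim by (simp add: D_def analyticity_domain_def)
    qed
  qed
  have fb_cont: "(fb \<longlongrightarrow> fb z) (at z)" if z: "z \<in> ball 0 1" for z
  proof -
    \<comment> \<open>The kernel identity at \<open>w = 0\<close> writes \<open>\<phi>\<close> as a
      combination of the functions \<open>R_fun\<close>, which are visibly continuous off 1.\<close>
    define h where "h w = (\<Sum>i<k. \<Sum>j<k. R_fun i w * X $$ (i, j) * cnj (R_fun j 0)) - cnj (\<phi> 0) + 1 / e" for w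
    have h: "fb w = h w" if "w \<noteq> 1" for w
      using phi_kernel[rule_format, of w 0] that by (simp add: fb_def h_def \<phi>_def algebra_simps)
    have z1: "z \<noteq> 1" by (rule ball1[OF z])
    have "(h \<longlongrightarrow> h z) (at z)"
      unfolding h_def R_fun_def by (intro tendsto_intros) (use z1 in auto)
    moreover have "\<forall>\<^sub>F w in at z. h w = fb w"
      using eventually_neq_at_within[of 1 z UNIV] by eventually_elim (simp add: h)
    ultimately show ?thesis
      using h[OF z1] by (metis Lim_transform_eventually)
  qed
  show ?thesis
  proof
    fix z :: complex assume z: "z \<in> ball 0 1"
    have ev1: "\<forall>\<^sub>F w in at z. g w * fb w = 1"
      using D_near[OF z] by eventually_elim (rule g_fb)
    show "s z = b z"
    proof (cases "is_pole s z")
      case False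
      then have an: "s analytic_on {z}"
        by (rule nicely_meromorphic_on_imp_analytic_at[OF mero z])
      then have "(s \<longlongrightarrow> s z) (at z)"
        using analytic_at_imp_isCont isContD by blast
      then have "(g \<longlongrightarrow> g z) (at z)"
        unfolding g_def by (intro tendsto_intros)
      from tendsto_mult[OF this fb_cont[OF z]]
      have "((\<lambda>w. g w * fb w) \<longlongrightarrow> g z * fb z) (at z)" .
      from Lim_transform_eventually[OF this ev1]
      have gf: "g z * fb z = 1"
        by (simp add: tendsto_const_iff)
      then have "fb z \<noteq> 0" by auto
      then have "g z = 1 / fb z" using gf by (simp add: nonzero_eq_divide_eq)
      then have "1 - cnj t * s z = 1 - cnj t * b z"
        using b_fb[OF \<open>fb z \<noteq> 0\<close>] by (simp only: g_def)
      then show ?thesis using t0 by simp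
    next
      case True
      then have s0: "s z = 0"
        using mero z not_tendsto_and_filterlim_at_infinity[OF at_neq_bot]
        unfolding nicely_meromorphic_on_def is_pole_def by blast
      \<comment> \<open>At a pole \<open>g\<close> tends to infinity, so its reciprocal
        \<open>fb\<close> tends to 0 and vanishes at \<open>z\<close> by continuity;
        \<open>s\<close> and \<open>b\<close> then both take the default value 0.\<close>
      have "filterlim g at_infinity (at z)"
      proof -
        have "filterlim (\<lambda>w. - cnj t * s w) at_infinity (at z)"
          using True t0 unfolding is_pole_def
          by (intro tendsto_mult_filterlim_at_infinity[OF tendsto_const]) auto
        from tendsto_add_filterlim_at_infinity[OF tendsto_const[of 1] this]
        show ?thesis by (simp add: g_def[abs_def])
      qed
      then have "((\<lambda>w. inverse (g w)) \<longlongrightarrow> 0) (at z)"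
        by (rule filterlim_compose[OF tendsto_inverse_0])
      moreover have "\<forall>\<^sub>F w in at z. inverse (g w) = fb w"
        using ev1 by eventually_elim (metis inverse_unique)
      ultimately have "(fb \<longlongrightarrow> 0) (at z)"
        by (rule Lim_transform_eventually)
      then have "fb z = 0"
        using fb_cont[OF z] by (metis LIM_unique)
      then show ?thesis using b_pole s0 by simp
    qed
  qed
qed

end
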